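(* Let $Q$ be a finite acyclic quiver, $\mathbf d\in\mathbb N^{Q_0}$ a dimension vector and $\theta\in\mathbb Z^{Q_0}$ a generic stability parameter for $\mathbf d$. Let $\mathbf V=((V_i)_{i\in Q_0},(X_\alpha)_{\alpha\in Q_1},(Y_{\overline\alpha})_{\alpha\in Q_1})\in\mu_{\mathbb C}^{-1}(0)^{\theta\text{-}s}$ be a $\theta$-stable Nakajima quiver representation of dimension vector $\mathbf d$. Then the point $[\mathbf V]\in\mathcal M^\theta(\overline Q,\mathbf d)$ is fixed by the $\mathbb C^*$-action $t\cdot(V,X,Y)=(V,X,tY)$ if and only if there exists an integer $\ell>0$ such that: (i) for each $i\in Q_0$ there is a splitting $V_i=\bigoplus_{n=1}^{\ell}V_{i,n}$ into linear subspaces; (ii) for each $\alpha\in Q_1$, $X_\alpha(V_{t\alpha,n})\subseteq V_{h\alpha,n}$ for $n=1,\dots,\ell$, and $Y_{\overline\alpha}(V_{h\alpha,n})\subseteq V_{t\alpha,n+1}$ for $n=1,\dots,\ell-1$, while $Y_{\overline\alpha}(V_{h\alpha,\ell})=0$.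
   Context: Let $Q=(Q_0,Q_1,h,t)$ be a finite quiver with head and tail maps $h,t:Q_1\to Q_0$. The doubled quiver $\overline Q$ has the same vertices and, in addition to each $\alpha\in Q_1$, an opposite arrow $\overline\alpha$ from $h\alpha$ to $t\alpha$. A $\mathbf d$-dimensional representation of $\overline Q$ is $\mathbf V=(V,X,Y)$ with $V_i=\mathbb C^{d_i}$ and linear maps $X_\alpha:V_{t\alpha}\to V_{h\alpha}$, $Y_{\overline\alpha}:V_{h\alpha}\to V_{t\alpha}$; these form the affine space $\operatorname{Rep}(\overline Q,\mathbf d)$, on which $\operatorname{GL}(\mathbf d)=\prod_i\operatorname{GL}(d_i)$ acts by conjugation. The complex moment map is $\mu_{\mathbb C}(\mathbf V)=\big(\sum_{h\alpha=i}X_\alpha Y_{\overline\alpha}-\sum_{t\alpha=i}Y_{\overline\alpha}X_\alpha\big)_{i\in Q_0}$ (sums over $\alpha\in Q_1$); points of $\mu_{\mathbb C}^{-1}(0)$ are called Nakajima quiver representations. Generic means $\theta\cdot\mathbf d=0$ and $\theta\cdot\mathbf e\neq0$ for every $\mathbf e\in\mathbb N^{Q_0}$ with $\mathbf e\le\mathbf d$ componentwise, $\mathbf e\ne 0,\mathbf d$. $\mathbf V$ is $\theta$-stable if $\mu_\theta(\mathbf W)<\mu_\theta(\mathbf V)$ for all proper nonzero subrepresentations $\mathbf W$, where $\mu_\theta(\mathbf W)=\theta\cdot\mathbf d_{\mathbf W}/|\mathbf d_{\mathbf W}|$, $\mathbf d_{\mathbf W}$ is the dimension vector of $\mathbf W$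 and $|\mathbf d_{\mathbf W}|=\sum_i\dim W_i$. $\mathcal M^\theta(\overline Q,\mathbf d)=\mu_{\mathbb C}^{-1}(0)^{\theta\text{-}s}/\!/\operatorname{GL}(\mathbf d)$ is the (geometric) GIT quotient, parametrizing isomorphism classes $[\mathbf V]$ of $\theta$-stable Nakajima quiver representations. The action $t\cdot(V,X,Y)=(V,X,tY)$ of $\mathbb C^*$ descends to it. *)

theory Defs
  imports
    "Graph_Theory.Digraph"
    "Jordan_Normal_Form.VS_Connect"
    "HOL-Algebra.Group_Action"
    "HOL-Algebra.Product_Groups"
begin

text \<open>
  A finite quiver is a \<^locale>\<open>fin_digraph\<close> (loops, parallel arrows and an empty set of arrows are
  allowed).  A dimension vector is a function on vertices, of which only the values on
  \<^term>\<open>verts Q\<close> matter.  The space at the vertex \<open>i\<close> is always \<^term>\<open>carrier_vec (d i) :: complex vec set\<close>,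
  so a representation is given by its matrices alone.  Representations and elements of the gauge group
  are extensional functions, so that equality of functions is equality of
  representations.
\<close>

definition Rep :: "('v, 'a) pre_digraph \<Rightarrow> ('v \<Rightarrow> nat) \<Rightarrow> ('a \<Rightarrow> complex mat) set" where
  "Rep Q d = (\<Pi>\<^sub>E a\<in>arcs Q. carrier_mat (d (head Q a)) (d (tail Q a)))"

definition GL :: "('v, 'a) pre_digraph \<Rightarrow> ('v \<Rightarrow> nat) \<Rightarrow> ('v \<Rightarrow> complex mat) monoid" where
  "GL Q d = product_group (verts Q) (\<lambda>i. units_of (ring_mat TYPE(complex) (d i) ()))"

definition conj_act ::
  "('v, 'a) pre_digraph \<Rightarrow> ('v \<Rightarrow> nat) \<Rightarrow> ('v \<Rightarrow> complex mat) \<Rightarrow> ('a \<Rightarrow> complex mat) \<Rightarrow> ('a \<Rightarrow> complex mat)"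
where
  "conj_act Q d g V = (\<lambda>a\<in>arcs Q. g (head Q a) * V a * (inv\<^bsub>GL Q d\<^esub> g) (tail Q a))"

text \<open>\<open>Inl a\<close> is the arrow \<open>a\<close> of \<open>Q\<close> and \<open>Inr a\<close> the opposite arrow.\<close>

definition double :: "('v, 'a) pre_digraph \<Rightarrow> ('v, 'a + 'a) pre_digraph" where
  "double Q = \<lparr> verts = verts Q, arcs = arcs Q <+> arcs Q,
                tail = case_sum (tail Q) (head Q), head = case_sum (head Q) (tail Q) \<rparr>"

definition moment_map ::
  "('v, 'a) pre_digraph \<Rightarrow> ('v \<Rightarrow> nat) \<Rightarrow> ('a + 'a \<Rightarrow> complex mat) \<Rightarrow> 'v \<Rightarrow> complex mat"
where
  "moment_map Q d V = (\<lambda>i\<in>verts Q.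
     (\<Oplus>\<^bsub>ring_mat TYPE(complex) (d i) ()\<^esub> a\<in>{a \<in> arcs Q. head Q a = i}. V (Inl a) * V (Inr a)) -
     (\<Oplus>\<^bsub>ring_mat TYPE(complex) (d i) ()\<^esub> a\<in>{a \<in> arcs Q. tail Q a = i}. V (Inr a) * V (Inl a)))"

definition nakajima :: "('v, 'a) pre_digraph \<Rightarrow> ('v \<Rightarrow> nat) \<Rightarrow> ('a + 'a \<Rightarrow> complex mat) set" where
  "nakajima Q d = {V \<in> Rep (double Q) d. moment_map Q d V = (\<lambda>i\<in>verts Q. 0\<^sub>m (d i) (d i))}"

text \<open>Linear subspaces of \<open>\<complex>\<^sup>n\<close>, their dimension, and internal direct sums
  \<open>\<complex>\<^sup>n = U 1 \<oplus> \<dots> \<oplus> U l\<close>.\<close>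

definition lin_subspace :: "nat \<Rightarrow> complex vec set \<Rightarrow> bool" where
  "lin_subspace n W \<longleftrightarrow> VectorSpace.subspace class_ring W (module_vec TYPE(complex) n)"

definition subspace_dim :: "nat \<Rightarrow> complex vec set \<Rightarrow> nat" where
  "subspace_dim n W = vectorspace.dim class_ring ((module_vec TYPE(complex) n)\<lparr>carrier := W\<rparr>)"

definition splitting :: "nat \<Rightarrow> nat \<Rightarrow> (nat \<Rightarrow> complex vec set) \<Rightarrow> bool" where
  "splitting n l U \<longleftrightarrow>
     (\<forall>k\<in>{1..l}. lin_subspace n (U k)) \<and>
     (\<forall>v\<in>carrier_vec n. \<exists>!u. u \<in> (\<Pi>\<^sub>E k\<in>{1..l}. U k) \<and> v = finsum_vec TYPE(complex) n u {1..l})"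

definition subrep ::
  "('v, 'a) pre_digraph \<Rightarrow> ('v \<Rightarrow> nat) \<Rightarrow> ('a \<Rightarrow> complex mat) \<Rightarrow> ('v \<Rightarrow> complex vec set) \<Rightarrow> bool"
where
  "subrep Q d V W \<longleftrightarrow>
     (\<forall>i\<in>verts Q. lin_subspace (d i) (W i)) \<and>
     (\<forall>a\<in>arcs Q. \<forall>w\<in>W (tail Q a). V a *\<^sub>v w \<in> W (head Q a))"

definition pairing :: "('v, 'a) pre_digraph \<Rightarrow> ('v \<Rightarrow> int) \<Rightarrow> ('v \<Rightarrow> nat) \<Rightarrow> int" where
  "pairing Q \<theta> e = (\<Sum>i\<in>verts Q. \<theta> i * int (e i))"

definition generic :: "('v, 'a) pre_digraph \<Rightarrow> ('v \<Rightarrow> nat) \<Rightarrow> ('v \<Rightarrow> int) \<Rightarrow> bool" where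
  "generic Q d \<theta> \<longleftrightarrow> pairing Q \<theta> d = 0 \<and>
     (\<forall>e. (\<forall>i\<in>verts Q. e i \<le> d i) \<and> (\<exists>i\<in>verts Q. e i \<noteq> 0) \<and> (\<exists>i\<in>verts Q. e i \<noteq> d i)
        \<longrightarrow> pairing Q \<theta> e \<noteq> 0)"

definition slope :: "('v, 'a) pre_digraph \<Rightarrow> ('v \<Rightarrow> int) \<Rightarrow> ('v \<Rightarrow> nat) \<Rightarrow> real" where
  "slope Q \<theta> e = real_of_int (pairing Q \<theta> e) / real (\<Sum>i\<in>verts Q. e i)"

definition stable ::
  "('v, 'a) pre_digraph \<Rightarrow> ('v \<Rightarrow> nat) \<Rightarrow> ('v \<Rightarrow> int) \<Rightarrow> ('a \<Rightarrow> complex mat) \<Rightarrow> bool"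
where
  "stable Q d \<theta> V \<longleftrightarrow>
     (\<forall>W. subrep Q d V W \<and> (\<exists>i\<in>verts Q. W i \<noteq> {0\<^sub>v (d i)}) \<and> (\<exists>i\<in>verts Q. W i \<noteq> carrier_vec (d i))
        \<longrightarrow> slope Q \<theta> (\<lambda>i. subspace_dim (d i) (W i)) < slope Q \<theta> d)"

definition stable_locus ::
  "('v, 'a) pre_digraph \<Rightarrow> ('v \<Rightarrow> nat) \<Rightarrow> ('v \<Rightarrow> int) \<Rightarrow> ('a + 'a \<Rightarrow> complex mat) set"
where
  "stable_locus Q d \<theta> = {V \<in> nakajima Q d. stable (double Q) d \<theta> V}"

text \<open>
  The points of the geometric quotient are the orbits of the gauge group in the stable locus, that
  is, the isomorphism classes of stable Nakajima representations.
\<close>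

definition iso_class ::
  "('v, 'a) pre_digraph \<Rightarrow> ('v \<Rightarrow> nat) \<Rightarrow> ('a + 'a \<Rightarrow> complex mat) \<Rightarrow> ('a + 'a \<Rightarrow> complex mat) set"
where
  "iso_class Q d V = orbit (GL (double Q) d) (conj_act (double Q) d) V"

definition moduli ::
  "('v, 'a) pre_digraph \<Rightarrow> ('v \<Rightarrow> nat) \<Rightarrow> ('v \<Rightarrow> int) \<Rightarrow> ('a + 'a \<Rightarrow> complex mat) set set"
where
  "moduli Q d \<theta> = orbits (GL (double Q) d) (stable_locus Q d \<theta>) (conj_act (double Q) d)"

definition cstar_act ::
  "('v, 'a) pre_digraph \<Rightarrow> complex \<Rightarrow> ('a + 'a \<Rightarrow> complex mat) \<Rightarrow> ('a + 'a \<Rightarrow> complex mat)"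
where
  "cstar_act Q t V =
     (\<lambda>b\<in>arcs (double Q). case b of Inl a \<Rightarrow> V (Inl a) | Inr a \<Rightarrow> t \<cdot>\<^sub>m V (Inr a))"

text \<open>The induced action on the quotient takes direct images of orbits; see
  \<open>cstar_iso_class\<close> below.\<close>

definition cstar_moduli ::
  "('v, 'a) pre_digraph \<Rightarrow> complex \<Rightarrow> ('a + 'a \<Rightarrow> complex mat) set \<Rightarrow> ('a + 'a \<Rightarrow> complex mat) set"
where
  "cstar_moduli Q t P = cstar_act Q t ` P"

definition cstar_fixed ::
  "('v, 'a) pre_digraph \<Rightarrow> ('v \<Rightarrow> nat) \<Rightarrow> ('v \<Rightarrow> int) \<Rightarrow> ('a + 'a \<Rightarrow> complex mat) set set"
where
  "cstar_fixed Q d \<theta> = {P \<in> moduli Q d \<theta>. \<forall>t. t \<noteq> 0 \<longrightarrow> cstar_moduli Q t P = P}"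

lemma GL_carrier_mat:
  assumes "g \<in> carrier (GL Q d)" "i \<in> verts Q"
  shows "g i \<in> carrier_mat (d i) (d i)" "(inv\<^bsub>GL Q d\<^esub> g) i \<in> carrier_mat (d i) (d i)"
proof -
  let ?U = "\<lambda>i. units_of (ring_mat TYPE(complex) (d i) ())"
  have grp: "group (?U i)" for i
    by (intro monoid.units_group ring.is_monoid ring_mat)
  have g: "g \<in> (\<Pi>\<^sub>E i\<in>verts Q. carrier (?U i))"
    using assms(1) by (simp add: GL_def)
  have sub: "carrier (?U i) \<subseteq> carrier_mat (d i) (d i)"
    by (auto simp: units_of_def Units_def ring_mat_def)
  show "g i \<in> carrier_mat (d i) (d i)"
    using g assms(2) sub by auto
  have "(inv\<^bsub>GL Q d\<^esub> g) i = inv\<^bsub>?U i\<^esub> (g i)"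
    using inv_product_group[OF g grp] assms(2) by (simp add: GL_def)
  then show "(inv\<^bsub>GL Q d\<^esub> g) i \<in> carrier_mat (d i) (d i)"
    using group.inv_closed[OF grp] g assms(2) sub by (metis PiE_mem subsetD)
qed

lemma (in wf_digraph) cstar_iso_class:
  assumes "V \<in> Rep (double G) d"
  shows "cstar_moduli G t (iso_class G d V) = iso_class G d (cstar_act G t V)"
proof -
  have "cstar_act G t (conj_act (double G) d g V) = conj_act (double G) d g (cstar_act G t V)"
    if g: "g \<in> carrier (GL (double G) d)" for g
  proof
    fix b
    note mats = GL_carrier_mat[OF g]
    show "cstar_act G t (conj_act (double G) d g V) b = conj_act (double G) d g (cstar_act G t V) b"
    proof (cases "b \<in> arcs (double G)")
      case True
      then have V: "V b \<in> carrier_mat (d (head (double G) b)) (d (tail (double G) b))"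
        using assms by (auto simp: Rep_def)
      have ends: "head (double G) b \<in> verts (double G)" "tail (double G) b \<in> verts (double G)"
        using True by (auto simp: double_def)
      show ?thesis
        using True V mats(1)[OF ends(1)] mats(2)[OF ends(2)]
        by (cases b) (auto simp: cstar_act_def conj_act_def mult_smult_distrib[of _ _ "d (head (double G) b)"]
            mult_smult_assoc_mat[of _ "d (head (double G) b)" "d (tail (double G) b)"])
    qed (simp add: cstar_act_def conj_act_def)
  qed
  then show ?thesis
    by (auto simp: cstar_moduli_def iso_class_def orbit_def image_iff) metis+
qed

end

theory Submission
  imports Defs "Jordan_Normal_Form.Jordan_Normal_Form_Existence"
begin

text \<open>
  A grading for which \<open>X\<close> has degree \<open>0\<close> and \<open>Y\<close> has degree \<open>1\<close> amounts to a one-parameter family of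
  changes of basis that undoes the scaling of \<open>Y\<close>.

  Given the splitting, let \<open>g\<^sub>t\<close> act on the \<open>n\<close>-th summand \<open>V\<^sub>i\<^sub>,\<^sub>n\<close> as the scalar \<open>t\<^sup>n\<close>.  Since \<open>X\<close>
  preserves the index and \<open>Y\<close> raises it by one (or kills the last summand), \<open>g\<^sub>t\<close> commutes with \<open>X\<close>
  and satisfies \<open>g\<^sub>t Y = t Y g\<^sub>t\<close>; so \<open>(X, t Y)\<close> is isomorphic to \<open>(X, Y)\<close>.  This is
  \<open>grading_imp_cstar_eigen\<close>.

  Conversely it is enough to look at one scalar \<open>t\<close> with \<open>\<bar>t\<bar> \<noteq> 1\<close>, here \<open>t = 2\<close>.  An
  isomorphism from \<open>(X, Y)\<close> to \<open>(X, 2 Y)\<close> is a family \<open>g\<close> of invertible matrices with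
  \<open>g X = X g\<close> and \<open>g Y = 2 Y g\<close>.  Hence \<open>X\<close> maps the generalized eigenspace of \<open>g\<close> for \<open>w\<close> into the one
  for \<open>w\<close>, and \<open>Y\<close> maps it into the one for \<open>2 w\<close>.  The eigenvalues are nonzero, so one can put
  the generalized eigenspace for \<open>w\<close> in degree \<open>\<lfloor>log\<^sub>2 \<bar>w\<bar>\<rfloor>\<close>: equal eigenvalues have equal degree and
  doubling raises the degree by exactly one.  Only finitely many eigenvalues occur, so after a shift
  the degrees lie in \<open>{1..l}\<close>, and \<open>Y\<close> kills degree \<open>l\<close> because nothing sits in degree \<open>l + 1\<close>.
  This is \<open>cstar_eigen_imp_grading\<close>.

  Generalized eigenspaces are handled in coordinates: write \<open>g\<^sub>i = P J R\<close> with \<open>R = P\<^sup>-\<^sup>1\<close> and \<open>J\<close> a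
  Jordan matrix, and give the \<open>k\<close>-th coordinate the weight \<open>J\<^sub>k\<^sub>k\<close>.  The statement about
  \<open>X\<close> and \<open>Y\<close> then says that their matrices in these coordinates have no entry between coordinates of
  unrelated weights (\<open>intertwiner_entry_weights\<close>), which is the uniqueness part of Sylvester's theorem on
  \<open>A X = X B\<close>.
\<close>

section \<open>Eigenvalue coordinates and intertwiners\<close>

lemma jordan_matrix_eigenvalue_blocks:
  assumes "i < sum_list (map fst n_as)" "j < sum_list (map fst n_as)"
    and "jordan_matrix n_as $$ (i, j) \<noteq> 0"
  shows "i \<le> j \<and> jordan_matrix n_as $$ (i, i) = jordan_matrix n_as $$ (j, j)"
  using assms
proof (induction n_as arbitrary: i j)
  case (Cons x n_as)
  obtain m a where x: "x = (m, a)" by force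
  let ?s = "sum_list (map fst n_as)"
  have J: "jordan_matrix (x # n_as) =
      four_block_mat (jordan_block m a) (0\<^sub>m m ?s) (0\<^sub>m ?s m) (jordan_matrix n_as)"
    using jordan_matrix_dim[of n_as] by (simp add: jordan_matrix_def Let_def x)
  have entry: "jordan_matrix (x # n_as) $$ (p, q) =
      (if p < m then if q < m then jordan_block m a $$ (p, q) else 0
       else if q < m then 0 else jordan_matrix n_as $$ (p - m, q - m))"
    if "p < m + ?s" "q < m + ?s" for p q
    unfolding J using that by (subst index_mat_four_block) (auto simp: not_less)
  have ij: "i < m + ?s" "j < m + ?s" "jordan_matrix (x # n_as) $$ (i, j) \<noteq> 0"
    using Cons.prems by (simp_all add: x)
  consider "i < m" "j < m" | "\<not> i < m" "\<not> j < m"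
    using ij entry[OF ij(1,2)] by (auto split: if_splits)
  then show ?case
  proof cases
    case 1
    then show ?thesis
      using ij(3) entry[of i j] entry[of i i] entry[of j j] by (simp split: if_splits)
  next
    case 2
    then have "i - m \<le> j - m \<and> jordan_matrix n_as $$ (i - m, i - m) = jordan_matrix n_as $$ (j - m, j - m)"
      using ij by (intro Cons.IH) (auto simp: entry)
    then show ?thesis
      using 2 ij(1,2) by (simp add: entry) linarith
  qed
qed simp

text \<open>
  What is needed of a Jordan matrix: it is upper triangular, and it is block diagonal with respect to
  the partition of the indices by their diagonal entry.  Unlike the shape of a Jordan matrix, this is
  stable under multiplication by a scalar.
\<close>

definition eigenblock_triangular :: "nat \<Rightarrow> complex mat \<Rightarrow> bool" where
  "eigenblock_triangular n J \<longleftrightarrow> J \<in> carrier_mat n n \<and>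
     (\<forall>i<n. \<forall>j<n. J $$ (i, j) \<noteq> 0 \<longrightarrow> i \<le> j \<and> J $$ (i, i) = J $$ (j, j))"

lemma eigenblock_triangularD:
  assumes "eigenblock_triangular n J"
  shows "J \<in> carrier_mat n n"
    and "i < n \<Longrightarrow> j < n \<Longrightarrow> J $$ (i, j) \<noteq> 0 \<Longrightarrow> i \<le> j"
    and "i < n \<Longrightarrow> j < n \<Longrightarrow> J $$ (i, j) \<noteq> 0 \<Longrightarrow> J $$ (i, i) = J $$ (j, j)"
  using assms unfolding eigenblock_triangular_def by blast+

text \<open>
  Comparing the entries at \<open>(k, l)\<close> of \<open>A X = X B\<close> expresses \<open>(A\<^sub>k\<^sub>k - B\<^sub>l\<^sub>l) X\<^sub>k\<^sub>l\<close> through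
  entries \<open>X\<^sub>j\<^sub>l\<close> with \<open>j > k\<close> and \<open>X\<^sub>k\<^sub>j\<close> with \<open>j < l\<close>.  The block structure makes sure that only
  entries between distinct diagonal values occur there, so they vanish by induction.
\<close>

lemma sylvester_entry_eq_0:
  assumes A: "eigenblock_triangular n A" and B: "eigenblock_triangular m B"
    and X: "X \<in> carrier_mat n m" and AX: "A * X = X * B"
    and k: "k < n" and l: "l < m" and ne: "A $$ (k, k) \<noteq> B $$ (l, l)"
  shows "X $$ (k, l) = 0"
  using k l ne
proof (induction "l + (n - k)" arbitrary: k l rule: less_induct)
  case less
  have "(\<Sum>j<n. A $$ (k, j) * X $$ (j, l)) = (\<Sum>j<m. X $$ (k, j) * B $$ (j, l))"
    using arg_cong[OF AX, of "\<lambda>M. M $$ (k, l)"] X less.prems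
      eigenblock_triangularD(1)[OF A] eigenblock_triangularD(1)[OF B]
    by (simp add: scalar_prod_def atLeast0LessThan)
  moreover have "\<forall>j\<in>{..<n} - {k}. A $$ (k, j) * X $$ (j, l) = 0"
  proof
    fix j assume "j \<in> {..<n} - {k}"
    then show "A $$ (k, j) * X $$ (j, l) = 0"
      using less.hyps[of l j] eigenblock_triangularD(2,3)[OF A, of k j] less.prems
      by (cases "A $$ (k, j) = 0") auto
  qed
  then have "(\<Sum>j<n. A $$ (k, j) * X $$ (j, l)) = A $$ (k, k) * X $$ (k, l)"
    using less.prems(1) by (subst sum.remove[of _ k]) (simp_all add: sum.neutral)
  moreover have "\<forall>j\<in>{..<m} - {l}. X $$ (k, j) * B $$ (j, l) = 0"
  proof
    fix j assume "j \<in> {..<m} - {l}"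
    then show "X $$ (k, j) * B $$ (j, l) = 0"
      using less.hyps[of j k] eigenblock_triangularD(2,3)[OF B, of j l] less.prems
      by (cases "B $$ (j, l) = 0") auto
  qed
  then have "(\<Sum>j<m. X $$ (k, j) * B $$ (j, l)) = X $$ (k, l) * B $$ (l, l)"
    using less.prems(2) by (subst sum.remove[of _ l]) (simp_all add: sum.neutral)
  ultimately have "(A $$ (k, k) - B $$ (l, l)) * X $$ (k, l) = 0"
    by (simp add: algebra_simps)
  with less.prems(3) show ?case by simp
qed

definition inverse_pair :: "nat \<Rightarrow> complex mat \<Rightarrow> complex mat \<Rightarrow> bool" where
  "inverse_pair n P R \<longleftrightarrow>
     P \<in> carrier_mat n n \<and> R \<in> carrier_mat n n \<and> P * R = 1\<^sub>m n \<and> R * P = 1\<^sub>m n"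

lemma eigenvalue_coordinates_exist:
  fixes g :: "complex mat"
  assumes "inverse_pair n g g'"
  shows "\<exists>P R J. inverse_pair n P R \<and> eigenblock_triangular n J \<and> g = P * J * R \<and>
    (\<forall>i<n. J $$ (i, i) \<noteq> 0)"
proof -
  have g: "g \<in> carrier_mat n n" and g': "g' \<in> carrier_mat n n" and gg': "g * g' = 1\<^sub>m n"
    using assms by (auto simp: inverse_pair_def)
  obtain as where "char_poly g = (\<Prod>a\<leftarrow>as. [:- a, 1:])"
    using char_poly_factorized[OF g] by blast
  from jordan_nf_exists[OF g this] obtain n_as where jnf: "jordan_nf g n_as" ..
  then have "similar_mat g (jordan_matrix n_as)"
    by (simp add: jordan_nf_def)
  then obtain P R where w: "similar_mat_wit g (jordan_matrix n_as) P R"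
    unfolding similar_mat_def by (elim exE) rule
  let ?J = "jordan_matrix n_as"
  note w = similar_mat_witD2[OF g w]
  have n: "sum_list (map fst n_as) = n"
    using carrier_matD(1)[OF w(5)] jordan_matrix_dim(1)[of n_as] by simp
  have nz: "?J $$ (i, i) \<noteq> 0" if "i < n" for i
  proof -
    have "det g \<noteq> 0"
      using arg_cong[OF gg', of det] det_mult[OF g g'] by auto
    moreover have "det g = det ?J"
      using jnf by (intro det_similar) (simp add: jordan_nf_def)
    moreover have "det ?J = prod_list (diag_mat ?J)"
      using w(5) by (intro det_upper_triangular) (auto simp: n jordan_matrix_upper_triangular)
    moreover have "?J $$ (i, i) \<in> set (diag_mat ?J)"
      using that w(5) by (auto simp: diag_mat_def)
    ultimately show ?thesis
      by (metis prod_list_zero_iff)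
  qed
  have "inverse_pair n P R"
    using w by (auto simp: inverse_pair_def)
  moreover have "eigenblock_triangular n ?J"
    unfolding eigenblock_triangular_def
    using jordan_matrix_eigenvalue_blocks[of _ n_as] w(5) by (auto simp: n)
  moreover have "\<forall>i<n. ?J $$ (i, i) \<noteq> 0"
    using nz by blast
  ultimately have "inverse_pair n P R \<and> eigenblock_triangular n ?J \<and> g = P * ?J * R \<and>
      (\<forall>i<n. ?J $$ (i, i) \<noteq> 0)"
    using w(3) by (intro conjI)
  then show ?thesis
    by (intro exI[of _ P] exI[of _ R] exI[of _ ?J])
qed

text \<open>
  \<open>R\<close> is the matrix that computes coordinates: for invertible \<open>R\<close> this is the span of the columns of
  \<open>R\<^sup>-\<^sup>1\<close> with index in \<open>S\<close>.
\<close>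

definition coord_span :: "nat \<Rightarrow> complex mat \<Rightarrow> nat set \<Rightarrow> complex vec set" where
  "coord_span n R S = {v \<in> carrier_vec n. \<forall>k<n. k \<notin> S \<longrightarrow> (R *\<^sub>v v) $ k = 0}"

lemma lin_subspace_iff:
  "lin_subspace n W \<longleftrightarrow> W \<subseteq> carrier_vec n \<and> 0\<^sub>v n \<in> W \<and>
     (\<forall>v\<in>W. \<forall>w\<in>W. v + w \<in> W) \<and> (\<forall>c. \<forall>v\<in>W. c \<cdot>\<^sub>v v \<in> W)"
proof -
  have "lin_subspace n W \<longleftrightarrow> LinearCombinations.submodule class_ring W (module_vec TYPE(complex) n)"
    using vec_vs[where ?'a = complex] by (simp add: lin_subspace_def VectorSpace.subspace_def)
  also have "\<dots> \<longleftrightarrow> W \<subseteq> carrier_vec n \<and> 0\<^sub>v n \<in> W \<and>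
     (\<forall>v\<in>W. \<forall>w\<in>W. v + w \<in> W) \<and> (\<forall>c. \<forall>v\<in>W. c \<cdot>\<^sub>v v \<in> W)"
    unfolding LinearCombinations.submodule_def module_vec_simps
    using vec_module by (simp; blast)
  finally show ?thesis .
qed

lemma coord_span_subspace:
  assumes "R \<in> carrier_mat n n"
  shows "lin_subspace n (coord_span n R S)"
  unfolding lin_subspace_iff
proof (intro conjI ballI allI)
  note R = mult_add_distrib_mat_vec[OF assms] mult_mat_vec[OF assms]
  show "v + w \<in> coord_span n R S" if "v \<in> coord_span n R S" "w \<in> coord_span n R S" for v w
    using that assms by (simp add: coord_span_def R(1) del: index_mult_mat_vec)
  show "c \<cdot>\<^sub>v v \<in> coord_span n R S" if "v \<in> coord_span n R S" for v c
    using that assms by (simp add: coord_span_def R(2) del: index_mult_mat_vec)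
  show "0\<^sub>v n \<in> coord_span n R S"
    using assms by (simp add: coord_span_def)
  show "coord_span n R S \<subseteq> carrier_vec n"
    unfolding coord_span_def by blast
qed

lemma mult_mat_vec_entry:
  assumes "A \<in> carrier_mat n m" "v \<in> carrier_vec m" "i < n"
  shows "(A *\<^sub>v v) $ i = (\<Sum>j<m. A $$ (i, j) * v $ j)"
  using assms by (simp add: scalar_prod_def atLeast0LessThan)

lemma inverse_pair_cancel:
  assumes "inverse_pair n P R" "v \<in> carrier_vec n"
  shows "P *\<^sub>v (R *\<^sub>v v) = v" "R *\<^sub>v (P *\<^sub>v v) = v"
  using assms assoc_mult_mat_vec[of P n n R n v] assoc_mult_mat_vec[of R n n P n v]
  by (auto simp: inverse_pair_def)

lemma coord_span_empty:
  assumes "inverse_pair n P R" "S \<inter> {..<n} = {}"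
  shows "coord_span n R S = {0\<^sub>v n}"
proof -
  have PR: "P \<in> carrier_mat n n" "R \<in> carrier_mat n n"
    using assms by (auto simp: inverse_pair_def)
  have "v = 0\<^sub>v n" if "v \<in> coord_span n R S" for v
  proof -
    have "R *\<^sub>v v = 0\<^sub>v n"
      using that assms(2) PR by (intro eq_vecI) (auto simp: coord_span_def)
    then show ?thesis
      using inverse_pair_cancel(1)[OF assms(1), of v] that PR
      by (auto simp: coord_span_def)
  qed
  then show ?thesis
    using PR by (auto simp: coord_span_def)
qed

lemma coord_span_mapsto:
  assumes h: "inverse_pair n P R" and t: "inverse_pair m P' R'" and X: "X \<in> carrier_mat n m"
    and entries: "\<And>k l. k < n \<Longrightarrow> l < m \<Longrightarrow> (R * X * P') $$ (k, l) \<noteq> 0 \<Longrightarrow> l \<in> S' \<Longrightarrow> k \<in> S"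
    and v: "v \<in> coord_span m R' S'"
  shows "X *\<^sub>v v \<in> coord_span n R S"
proof -
  have c: "R \<in> carrier_mat n n" "P' \<in> carrier_mat m m" "R' \<in> carrier_mat m m" "v \<in> carrier_vec m"
    using h t v by (auto simp: inverse_pair_def coord_span_def)
  have "R *\<^sub>v (X *\<^sub>v v) = R *\<^sub>v (X *\<^sub>v (P' *\<^sub>v (R' *\<^sub>v v)))"
    using inverse_pair_cancel[OF t c(4)] by simp
  also have "\<dots> = (R * X * P') *\<^sub>v (R' *\<^sub>v v)"
    using c X by (simp add: assoc_mult_mat_vec[of _ n m _ m] assoc_mult_mat_vec[of _ n n _ m])
  finally have eq: "R *\<^sub>v (X *\<^sub>v v) = (R * X * P') *\<^sub>v (R' *\<^sub>v v)" .
  have "(R *\<^sub>v (X *\<^sub>v v)) $ k = 0" if "k < n" "k \<notin> S" for k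
  proof -
    have "(R *\<^sub>v (X *\<^sub>v v)) $ k = (\<Sum>l<m. (R * X * P') $$ (k, l) * (R' *\<^sub>v v) $ l)"
      unfolding eq using c X that by (intro mult_mat_vec_entry) auto
    also have "\<dots> = 0"
      using entries[OF \<open>k < n\<close>] that v by (intro sum.neutral) (auto simp: coord_span_def)
    finally show ?thesis .
  qed
  then show ?thesis
    using X c by (simp add: coord_span_def)
qed

text \<open>
  Conjugation into the coordinates turns \<open>g X = c X g'\<close> into Sylvester's equation
  \<open>J (R X P') = (R X P') (c J')\<close>.
\<close>

lemma intertwiner_entry_weights:
  assumes h: "inverse_pair n P R" and t: "inverse_pair m P' R'"
    and J: "eigenblock_triangular n J" and J': "eigenblock_triangular m J'"
    and X: "X \<in> carrier_mat n m"
    and inter: "(P * J * R) * X = c \<cdot>\<^sub>m (X * (P' * J' * R'))"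
    and kl: "k < n" "l < m" and ne: "(R * X * P') $$ (k, l) \<noteq> 0"
  shows "J $$ (k, k) = c * J' $$ (l, l)"
proof (rule ccontr)
  assume neq: "J $$ (k, k) \<noteq> c * J' $$ (l, l)"
  have c: "P \<in> carrier_mat n n" "R \<in> carrier_mat n n" "P' \<in> carrier_mat m m" "R' \<in> carrier_mat m m"
    "J \<in> carrier_mat n n" "J' \<in> carrier_mat m m" and RP: "R * P = 1\<^sub>m n" "R' * P' = 1\<^sub>m m"
    using assms by (auto simp: inverse_pair_def eigenblock_triangular_def)
  have "J * (R * X * P') = (R * P) * (J * (R * X * P'))"
    using RP c X by simp
  also have "\<dots> = R * ((P * J * R) * X) * P'"
    using c X by (simp add: assoc_mult_mat[of _ _ n _ n _ n] assoc_mult_mat[of _ _ n _ n _ m]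
        assoc_mult_mat[of _ _ n _ m _ m])
  also have "\<dots> = c \<cdot>\<^sub>m ((R * X * P') * (J' * (R' * P')))"
    unfolding inter using c X
    by (simp add: assoc_mult_mat[of _ _ n _ m _ m] assoc_mult_mat[of _ _ m _ m _ m]
        mult_smult_distrib[of _ n n _ m] mult_smult_assoc_mat[of _ n m _ m])
  also have "\<dots> = (R * X * P') * (c \<cdot>\<^sub>m J')"
    using RP c X by (simp add: mult_smult_distrib[of _ n m _ m])
  finally have eq: "J * (R * X * P') = (R * X * P') * (c \<cdot>\<^sub>m J')" .
  have "eigenblock_triangular m (c \<cdot>\<^sub>m J')"
    using J' by (auto simp: eigenblock_triangular_def)
  then have "(R * X * P') $$ (k, l) = 0"
    by (rule sylvester_entry_eq_0[OF J _ _ eq kl]) (use c X kl neq in auto)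
  with ne show False ..
qed

section \<open>Splittings and the matrices that scale their summands\<close>

lemma carrier_vec_eqI:
  assumes "x \<in> carrier_vec n" "y \<in> carrier_vec n" "\<And>j. j < n \<Longrightarrow> x $ j = y $ j"
  shows "x = y"
  using assms by (intro eq_vecI) auto

lemma additive_finsum_vec:
  fixes f :: "complex vec \<Rightarrow> complex vec"
  assumes closed: "\<And>v. v \<in> carrier_vec n \<Longrightarrow> f v \<in> carrier_vec m"
    and add: "\<And>v w. v \<in> carrier_vec n \<Longrightarrow> w \<in> carrier_vec n \<Longrightarrow> f (v + w) = f v + f w"
    and zero: "f (0\<^sub>v n) = 0\<^sub>v m"
    and "finite K" "u \<in> K \<rightarrow> carrier_vec n"
  shows "f (finsum_vec TYPE(complex) n u K) = finsum_vec TYPE(complex) m (\<lambda>k. f (u k)) K"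
  using assms(4,5)
proof (induction K rule: finite_induct)
  case empty
  show ?case by (simp only: finsum_vec_empty zero)
next
  case (insert k K)
  then have u: "u k \<in> carrier_vec n" "u \<in> K \<rightarrow> carrier_vec n" by auto
  then have fu: "f (u k) \<in> carrier_vec m" "(\<lambda>k. f (u k)) \<in> K \<rightarrow> carrier_vec m"
    using closed by auto
  have "f (finsum_vec TYPE(complex) n u (insert k K)) = f (u k + finsum_vec TYPE(complex) n u K)"
    using insert.hyps u by (subst finsum_vec_insert) auto
  also have "\<dots> = f (u k) + f (finsum_vec TYPE(complex) n u K)"
    using u by (intro add finsum_vec_closed)
  also have "\<dots> = finsum_vec TYPE(complex) m (\<lambda>k. f (u k)) (insert k K)"
    using insert.hyps fu insert.IH[OF u(2)] by (subst finsum_vec_insert) auto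
  finally show ?case .
qed

lemma mult_mat_vec_finsum_vec:
  assumes A: "A \<in> carrier_mat m n" and "finite K" "u \<in> K \<rightarrow> carrier_vec n"
  shows "A *\<^sub>v finsum_vec TYPE(complex) n u K = finsum_vec TYPE(complex) m (\<lambda>k. A *\<^sub>v u k) K"
  using assms(2,3)
proof (rule additive_finsum_vec[rotated 3])
  show "A *\<^sub>v (v + w) = A *\<^sub>v v + A *\<^sub>v w" if "v \<in> carrier_vec n" "w \<in> carrier_vec n" for v w
    using that by (rule mult_add_distrib_mat_vec[OF A])
  show "A *\<^sub>v 0\<^sub>v n = 0\<^sub>v m"
    using A by (intro eq_vecI) auto
qed (use A in auto)

lemma linear_map_is_matrix:
  fixes f :: "complex vec \<Rightarrow> complex vec"
  assumes closed: "\<And>v. v \<in> carrier_vec n \<Longrightarrow> f v \<in> carrier_vec m"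
    and add: "\<And>v w. v \<in> carrier_vec n \<Longrightarrow> w \<in> carrier_vec n \<Longrightarrow> f (v + w) = f v + f w"
    and smult: "\<And>c v. v \<in> carrier_vec n \<Longrightarrow> f (c \<cdot>\<^sub>v v) = c \<cdot>\<^sub>v f v"
  shows "\<exists>A\<in>carrier_mat m n. \<forall>v\<in>carrier_vec n. A *\<^sub>v v = f v"
proof (intro bexI ballI)
  let ?A = "mat m n (\<lambda>(i, j). f (unit_vec n j) $ i)"
  show A: "?A \<in> carrier_mat m n" by simp
  have zero: "f (0\<^sub>v n) = 0\<^sub>v m"
  proof -
    have "0 \<cdot>\<^sub>v 0\<^sub>v n = (0\<^sub>v n :: complex vec)" by (intro eq_vecI) auto
    moreover have "0 \<cdot>\<^sub>v f (0\<^sub>v n) = 0\<^sub>v m"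
      using carrier_vecD[OF closed[of "0\<^sub>v n"]] by (intro eq_vecI) auto
    ultimately show ?thesis
      using smult[of "0\<^sub>v n" 0] by simp
  qed
  fix v :: "complex vec" assume v: "v \<in> carrier_vec n"
  let ?u = "\<lambda>j. v $ j \<cdot>\<^sub>v unit_vec n j"
  have "v = finsum_vec TYPE(complex) n ?u {..<n}"
  proof (rule eq_vecI)
    have "finsum_vec TYPE(complex) n ?u {..<n} \<in> carrier_vec n"
      by (intro finsum_vec_closed) auto
    then show dim: "dim_vec v = dim_vec (finsum_vec TYPE(complex) n ?u {..<n})"
      using v by (metis carrier_vecD)
    fix i assume "i < dim_vec (finsum_vec TYPE(complex) n ?u {..<n})"
    then have i: "i < n" using v dim by (metis carrier_vecD)
    then have "finsum_vec TYPE(complex) n ?u {..<n} $ i = (\<Sum>j<n. ?u j $ i)"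
      by (intro index_finsum_vec) auto
    also have "\<dots> = (\<Sum>j<n. if j = i then v $ i else 0)"
      using i by (intro sum.cong) (auto simp: unit_vec_def)
    also have "\<dots> = v $ i" using i by simp
    finally show "v $ i = finsum_vec TYPE(complex) n ?u {..<n} $ i" by simp
  qed
  then have "f v = f (finsum_vec TYPE(complex) n ?u {..<n})"
    by (rule arg_cong)
  also have "\<dots> = finsum_vec TYPE(complex) m (\<lambda>j. f (?u j)) {..<n}"
    by (rule additive_finsum_vec) (auto simp: closed add zero)
  finally have fv: "f v = finsum_vec TYPE(complex) m (\<lambda>j. f (?u j)) {..<n}" .
  show "?A *\<^sub>v v = f v"
  proof (rule eq_vecI)
    show "dim_vec (?A *\<^sub>v v) = dim_vec (f v)"
      using carrier_vecD[OF closed[OF v]] by simp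
    fix i assume "i < dim_vec (f v)"
    then have i: "i < m" using closed[OF v] by (metis carrier_vecD)
    have "f v $ i = (\<Sum>j<n. f (?u j) $ i)"
      unfolding fv using i by (intro index_finsum_vec) (auto intro!: closed)
    also have "\<dots> = (\<Sum>j<n. ?A $$ (i, j) * v $ j)"
    proof (intro sum.cong refl)
      fix j assume "j \<in> {..<n}"
      moreover have "dim_vec (f (unit_vec n j)) = m"
        using closed[of "unit_vec n j"] by (metis carrier_vecD unit_vec_carrier)
      ultimately show "f (?u j) $ i = ?A $$ (i, j) * v $ j"
        using i by (simp add: smult)
    qed
    also have "\<dots> = (?A *\<^sub>v v) $ i"
      by (rule mult_mat_vec_entry[OF A v i, symmetric])
    finally show "(?A *\<^sub>v v) $ i = f v $ i" by simp
  qed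
qed

text \<open>
  The component of \<open>v\<close> in degree \<open>k\<close> is obtained by keeping the coordinates of degree \<open>k\<close> of \<open>R v\<close>
  and setting the others to \<open>0\<close>.
\<close>

lemma coord_span_splitting:
  assumes PR: "inverse_pair n P R" and \<nu>: "\<And>j. j < n \<Longrightarrow> \<nu> j \<in> {1..l}"
  shows "splitting n l (\<lambda>k. coord_span n R {j. \<nu> j = k})"
  unfolding splitting_def
proof (intro conjI ballI)
  have P: "P \<in> carrier_mat n n" and R: "R \<in> carrier_mat n n"
    using PR by (auto simp: inverse_pair_def)
  note eqI = carrier_vec_eqI[where n = n]
  let ?U = "\<lambda>k. coord_span n R {j. \<nu> j = k}"
  show "lin_subspace n (?U k)" for k
    using R by (rule coord_span_subspace)
  fix v :: "complex vec" assume v: "v \<in> carrier_vec n"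
  define c where "c k = vec n (\<lambda>j. if \<nu> j = k then (R *\<^sub>v v) $ j else 0)" for k
  have cc: "c k \<in> carrier_vec n" for k by (simp add: c_def)
  have Pc: "P *\<^sub>v c k \<in> carrier_vec n" for k using P cc by simp
  let ?u = "\<lambda>k\<in>{1..l}. P *\<^sub>v c k"
  \<comment> \<open>Each coordinate lives in a single degree, so a sum of components has just one contribution to it.\<close>
  have entries: "finsum_vec TYPE(complex) n w {1..l} $ j = w (\<nu> j) $ j"
    if "j < n" "w \<in> {1..l} \<rightarrow> carrier_vec n" "\<And>k. k \<in> {1..l} \<Longrightarrow> k \<noteq> \<nu> j \<Longrightarrow> w k $ j = 0" for w j
  proof -
    have "finsum_vec TYPE(complex) n w {1..l} $ j = (\<Sum>k\<in>{1..l}. w k $ j)"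
      using that(1,2) by (intro index_finsum_vec) auto
    also have "\<dots> = (\<Sum>k\<in>{1..l}. if k = \<nu> j then w k $ j else 0)"
      using that(3) by (intro sum.cong) auto
    also have "\<dots> = w (\<nu> j) $ j"
      using \<nu>[OF that(1)] by simp
    finally show ?thesis .
  qed
  show "\<exists>!u. u \<in> (\<Pi>\<^sub>E k\<in>{1..l}. ?U k) \<and> v = finsum_vec TYPE(complex) n u {1..l}"
  proof (rule ex1I)
    have "R *\<^sub>v (P *\<^sub>v c k) = c k" for k
      using inverse_pair_cancel(2)[OF PR cc] .
    then have "P *\<^sub>v c k \<in> ?U k" for k
      using Pc by (simp add: coord_span_def c_def del: index_mult_mat_vec)
    moreover have "v = finsum_vec TYPE(complex) n ?u {1..l}"
    proof -
      have fc: "finsum_vec TYPE(complex) n c {1..l} = R *\<^sub>v v"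
        using R v cc
        by (intro eqI finsum_vec_closed)
            (auto simp: entries c_def simp del: index_mult_mat_vec One_nat_def)
      have "v = P *\<^sub>v finsum_vec TYPE(complex) n c {1..l}"
        unfolding fc using inverse_pair_cancel(1)[OF PR v] by simp
      also have "\<dots> = finsum_vec TYPE(complex) n (\<lambda>k. P *\<^sub>v c k) {1..l}"
        using cc by (intro mult_mat_vec_finsum_vec[OF P]) auto
      also have "\<dots> = finsum_vec TYPE(complex) n ?u {1..l}"
        using Pc by (intro eqI finsum_vec_closed)
            (auto simp: index_finsum_vec simp del: index_mult_mat_vec)
      finally show ?thesis .
    qed
    ultimately show "?u \<in> (\<Pi>\<^sub>E k\<in>{1..l}. ?U k) \<and> v = finsum_vec TYPE(complex) n ?u {1..l}"
      by simp
  next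
    fix u assume "u \<in> (\<Pi>\<^sub>E k\<in>{1..l}. ?U k) \<and> v = finsum_vec TYPE(complex) n u {1..l}"
    then have u: "u \<in> (\<Pi>\<^sub>E k\<in>{1..l}. ?U k)" and vu: "v = finsum_vec TYPE(complex) n u {1..l}" by auto
    have uc: "u k \<in> carrier_vec n" if "k \<in> {1..l}" for k
      using PiE_mem[OF u that] by (simp add: coord_span_def)
    have "R *\<^sub>v v = finsum_vec TYPE(complex) n (\<lambda>k. R *\<^sub>v u k) {1..l}"
      unfolding vu using uc by (intro mult_mat_vec_finsum_vec[OF R]) auto
    moreover have "(R *\<^sub>v u k) $ j = 0" if "k \<in> {1..l}" "j < n" "k \<noteq> \<nu> j" for j k
      using PiE_mem[OF u that(1)] that by (simp add: coord_span_def del: index_mult_mat_vec)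
    ultimately have Rv: "(R *\<^sub>v v) $ j = (R *\<^sub>v u (\<nu> j)) $ j" if "j < n" for j
      using that uc R entries[of j "\<lambda>k. R *\<^sub>v u k"] by auto
    have "u k = P *\<^sub>v c k" if k: "k \<in> {1..l}" for k
    proof -
      have "R *\<^sub>v u k = c k"
        using R uc[OF k] cc PiE_mem[OF u k]
        by (intro eqI) (auto simp: c_def Rv coord_span_def simp del: index_mult_mat_vec)
      then show ?thesis
        using inverse_pair_cancel(1)[OF PR uc[OF k]] by simp
    qed
    then show "u = ?u"
      using PiE_arb[OF u] by (intro ext) (metis restrict_apply)
  qed
qed

lemma splittingD:
  assumes "splitting n l U" "k \<in> {1..l}"
  shows "v \<in> U k \<Longrightarrow> v \<in> carrier_vec n" and "0\<^sub>v n \<in> U k"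
    and "v \<in> U k \<Longrightarrow> w \<in> U k \<Longrightarrow> v + w \<in> U k" and "v \<in> U k \<Longrightarrow> c \<cdot>\<^sub>v v \<in> U k"
proof -
  have "lin_subspace n (U k)"
    using assms by (simp add: splitting_def)
  note * = this[unfolded lin_subspace_iff]
  show "v \<in> U k \<Longrightarrow> v \<in> carrier_vec n" and "0\<^sub>v n \<in> U k"
    and "v \<in> U k \<Longrightarrow> w \<in> U k \<Longrightarrow> v + w \<in> U k" and "v \<in> U k \<Longrightarrow> c \<cdot>\<^sub>v v \<in> U k"
    using * by (auto dest: subsetD)
qed

lemma finsum_vec_cong:
  fixes u w :: "'c \<Rightarrow> complex vec"
  assumes "u \<in> K \<rightarrow> carrier_vec n" "\<And>k. k \<in> K \<Longrightarrow> w k = u k"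
  shows "finsum_vec TYPE(complex) n w K = finsum_vec TYPE(complex) n u K"
  unfolding finsum_vec_def
  by (rule comm_monoid.finprod_cong'[OF comm_monoid_vec refl]) (use assms in \<open>auto simp: monoid_vec_simps\<close>)

lemma splitting_ext:
  assumes sp: "splitting n l U" and A: "A \<in> carrier_mat m n" and B: "B \<in> carrier_mat m n"
    and agree: "\<And>k v. k \<in> {1..l} \<Longrightarrow> v \<in> U k \<Longrightarrow> A *\<^sub>v v = B *\<^sub>v v"
  shows "A = B"
proof -
  have eq: "A *\<^sub>v v = B *\<^sub>v v" if v: "v \<in> carrier_vec n" for v
  proof -
    have "\<exists>!u. u \<in> (\<Pi>\<^sub>E k\<in>{1..l}. U k) \<and> v = finsum_vec TYPE(complex) n u {1..l}"
      using sp v by (simp add: splitting_def)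
    then obtain u where u: "u \<in> (\<Pi>\<^sub>E k\<in>{1..l}. U k)"
      and vu: "v = finsum_vec TYPE(complex) n u {1..l}" by (elim ex1E conjE)
    have uc: "u \<in> {1..l} \<rightarrow> carrier_vec n"
      by (rule Pi_I) (rule splittingD(1)[OF sp _ PiE_mem[OF u]])
    have "finsum_vec TYPE(complex) m (\<lambda>k. A *\<^sub>v u k) {1..l} = finsum_vec TYPE(complex) m (\<lambda>k. B *\<^sub>v u k) {1..l}"
    proof (rule finsum_vec_cong)
      show "(\<lambda>k. B *\<^sub>v u k) \<in> {1..l} \<rightarrow> carrier_vec m"
        by (rule Pi_I) (rule mult_mat_vec_carrier[OF B funcset_mem[OF uc]])
      show "A *\<^sub>v u k = B *\<^sub>v u k" if "k \<in> {1..l}" for k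
        by (rule agree[OF that PiE_mem[OF u that]])
    qed
    then show ?thesis
      unfolding vu using mult_mat_vec_finsum_vec[OF A _ uc] mult_mat_vec_finsum_vec[OF B _ uc] by simp
  qed
  show ?thesis
  proof (rule eq_matI)
    fix i j assume "i < dim_row B" "j < dim_col B"
    then have ij: "i < m" "j < n" using B by auto
    have "(A *\<^sub>v unit_vec n j) $ i = (B *\<^sub>v unit_vec n j) $ i"
      by (simp add: eq)
    then show "A $$ (i, j) = B $$ (i, j)"
      using A B ij by simp
  qed (use A B in auto)
qed

text \<open>
  The map in question takes \<open>v\<close> to the sum of \<open>c\<^sub>k u\<^sub>k\<close>, where \<open>u\<close> is the decomposition of \<open>v\<close>.
  Uniqueness of the decomposition makes \<open>v \<mapsto> u\<close> linear, hence this map has a matrix.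
\<close>

lemma splitting_scaling_matrix:
  assumes sp: "splitting n l U"
  shows "\<exists>G\<in>carrier_mat n n. \<forall>k\<in>{1..l}. \<forall>v\<in>U k. G *\<^sub>v v = c k \<cdot>\<^sub>v v"
proof -
  let ?F = "\<lambda>u. finsum_vec TYPE(complex) n u {1..l}"
  note sub = splittingD[OF sp]
  note eqI = carrier_vec_eqI[where n = n]
  have ex1: "\<exists>!u. u \<in> (\<Pi>\<^sub>E k\<in>{1..l}. U k) \<and> v = ?F u" if "v \<in> carrier_vec n" for v
    using sp that by (simp add: splitting_def)
  define comp where "comp v = (THE u. u \<in> (\<Pi>\<^sub>E k\<in>{1..l}. U k) \<and> v = ?F u)" for v
  have comp: "comp v \<in> (\<Pi>\<^sub>E k\<in>{1..l}. U k)" "v = ?F (comp v)" if "v \<in> carrier_vec n" for v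
    using theI'[OF ex1[OF that]] by (auto simp: comp_def)
  have comp_eq: "comp v = u" if "u \<in> (\<Pi>\<^sub>E k\<in>{1..l}. U k)" "v = ?F u" "v \<in> carrier_vec n" for u v
    using the1_equality[OF ex1[OF that(3)]] that by (simp add: comp_def)
  have PiEc: "u \<in> {1..l} \<rightarrow> carrier_vec n" if "u \<in> (\<Pi>\<^sub>E k\<in>{1..l}. U k)" for u
    by (rule Pi_I) (rule sub(1)[OF _ PiE_mem[OF that]])
  have Fc: "?F u \<in> carrier_vec n" if "u \<in> {1..l} \<rightarrow> carrier_vec n" for u
    using that by (rule finsum_vec_closed)
  have Fi: "?F u $ i = (\<Sum>k\<in>{1..l}. u k $ i)" if "u \<in> {1..l} \<rightarrow> carrier_vec n" "i < n" for u i
    using that by (intro index_finsum_vec) auto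
  have Fadd: "?F (\<lambda>k\<in>{1..l}. u k + w k) = ?F u + ?F w"
    if "u \<in> {1..l} \<rightarrow> carrier_vec n" "w \<in> {1..l} \<rightarrow> carrier_vec n" for u w
  proof (rule eqI)
    have uw: "(\<lambda>k\<in>{1..l}. u k + w k) \<in> {1..l} \<rightarrow> carrier_vec n"
      using that by (simp add: Pi_def)
    then show "?F (\<lambda>k\<in>{1..l}. u k + w k) \<in> carrier_vec n" by (rule Fc)
    show "?F u + ?F w \<in> carrier_vec n" using that by (intro add_carrier_vec Fc)
    fix j assume j: "j < n"
    have "(\<Sum>k\<in>{1..l}. (\<lambda>k\<in>{1..l}. u k + w k) k $ j) = (\<Sum>k\<in>{1..l}. u k $ j + w k $ j)"
    proof (intro sum.cong refl)
      fix k assume k: "k \<in> {1..l}"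
      then have "w k \<in> carrier_vec n" using that by auto
      then show "(\<lambda>k\<in>{1..l}. u k + w k) k $ j = u k $ j + w k $ j" using k j by simp
    qed
    then show "?F (\<lambda>k\<in>{1..l}. u k + w k) $ j = (?F u + ?F w) $ j"
      using j uw that Fc[OF that(2)] by (simp add: Fi sum.distrib del: One_nat_def)
  qed
  have Fsmult: "?F (\<lambda>k\<in>{1..l}. a \<cdot>\<^sub>v u k) = a \<cdot>\<^sub>v ?F u"
    if "u \<in> {1..l} \<rightarrow> carrier_vec n" for u a
  proof (rule eqI)
    have au: "(\<lambda>k\<in>{1..l}. a \<cdot>\<^sub>v u k) \<in> {1..l} \<rightarrow> carrier_vec n"
      using that by (simp add: Pi_def)
    then show "?F (\<lambda>k\<in>{1..l}. a \<cdot>\<^sub>v u k) \<in> carrier_vec n" by (rule Fc)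
    show "a \<cdot>\<^sub>v ?F u \<in> carrier_vec n" using Fc[OF that] by simp
    fix j assume j: "j < n"
    have "(\<Sum>k\<in>{1..l}. (\<lambda>k\<in>{1..l}. a \<cdot>\<^sub>v u k) k $ j) = (\<Sum>k\<in>{1..l}. a * u k $ j)"
    proof (intro sum.cong refl)
      fix k assume k: "k \<in> {1..l}"
      then have "u k \<in> carrier_vec n" using that by auto
      then show "(\<lambda>k\<in>{1..l}. a \<cdot>\<^sub>v u k) k $ j = a * u k $ j" using k j by simp
    qed
    then show "?F (\<lambda>k\<in>{1..l}. a \<cdot>\<^sub>v u k) $ j = (a \<cdot>\<^sub>v ?F u) $ j"
      using j au that Fc[OF that] by (simp add: Fi sum_distrib_left del: One_nat_def)
  qed
  define f where "f v = ?F (\<lambda>k\<in>{1..l}. c k \<cdot>\<^sub>v comp v k)" for v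
  have fin: "(\<lambda>k\<in>{1..l}. c k \<cdot>\<^sub>v comp v k) \<in> {1..l} \<rightarrow> carrier_vec n" if "v \<in> carrier_vec n" for v
    using PiEc[OF comp(1)[OF that]] by (simp add: Pi_def)
  have "\<exists>G\<in>carrier_mat n n. \<forall>v\<in>carrier_vec n. G *\<^sub>v v = f v"
  proof (rule linear_map_is_matrix)
    show "f v \<in> carrier_vec n" if "v \<in> carrier_vec n" for v
      unfolding f_def by (rule Fc[OF fin[OF that]])
    show "f (v + w) = f v + f w" if v: "v \<in> carrier_vec n" and w: "w \<in> carrier_vec n" for v w
    proof -
      note cv = comp[OF v] and cw = comp[OF w]
      have "comp (v + w) = (\<lambda>k\<in>{1..l}. comp v k + comp w k)"
      proof (rule comp_eq)
        show "(\<lambda>k\<in>{1..l}. comp v k + comp w k) \<in> (\<Pi>\<^sub>E k\<in>{1..l}. U k)"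
          unfolding restrict_PiE_iff using sub(3)[OF _ PiE_mem[OF cv(1)] PiE_mem[OF cw(1)]] by blast
        show "v + w = ?F (\<lambda>k\<in>{1..l}. comp v k + comp w k)"
          using Fadd[OF PiEc[OF cv(1)] PiEc[OF cw(1)]] cv(2) cw(2) by simp
      qed (use v w in simp)
      moreover have "(\<lambda>k\<in>{1..l}. c k \<cdot>\<^sub>v (\<lambda>k\<in>{1..l}. comp v k + comp w k) k) =
          (\<lambda>k\<in>{1..l}. (\<lambda>k\<in>{1..l}. c k \<cdot>\<^sub>v comp v k) k + (\<lambda>k\<in>{1..l}. c k \<cdot>\<^sub>v comp w k) k)"
        using PiEc[OF cv(1)] PiEc[OF cw(1)]
        by (intro restrict_ext) (simp add: Pi_def smult_add_distrib_vec[of _ n])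
      ultimately show ?thesis
        unfolding f_def using Fadd[OF fin[OF v] fin[OF w]] by simp
    qed
    show "f (a \<cdot>\<^sub>v v) = a \<cdot>\<^sub>v f v" if v: "v \<in> carrier_vec n" for a v
    proof -
      note cv = comp[OF v]
      have "comp (a \<cdot>\<^sub>v v) = (\<lambda>k\<in>{1..l}. a \<cdot>\<^sub>v comp v k)"
      proof (rule comp_eq)
        show "(\<lambda>k\<in>{1..l}. a \<cdot>\<^sub>v comp v k) \<in> (\<Pi>\<^sub>E k\<in>{1..l}. U k)"
          unfolding restrict_PiE_iff using sub(4)[OF _ PiE_mem[OF cv(1)]] by blast
        show "a \<cdot>\<^sub>v v = ?F (\<lambda>k\<in>{1..l}. a \<cdot>\<^sub>v comp v k)"
          using Fsmult[OF PiEc[OF cv(1)]] cv(2) by simp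
      qed (use v in simp)
      moreover have "(\<lambda>k\<in>{1..l}. c k \<cdot>\<^sub>v (\<lambda>k\<in>{1..l}. a \<cdot>\<^sub>v comp v k) k) =
          (\<lambda>k\<in>{1..l}. a \<cdot>\<^sub>v (\<lambda>k\<in>{1..l}. c k \<cdot>\<^sub>v comp v k) k)"
        by (intro restrict_ext) (simp add: smult_smult_assoc mult.commute)
      ultimately show ?thesis
        unfolding f_def using Fsmult[OF fin[OF v]] by simp
    qed
  qed
  then obtain G where G: "G \<in> carrier_mat n n" "\<And>v. v \<in> carrier_vec n \<Longrightarrow> G *\<^sub>v v = f v" by blast
  have "f v = c k \<cdot>\<^sub>v v" if k: "k \<in> {1..l}" and v: "v \<in> U k" for k v
  proof -
    have vc: "v \<in> carrier_vec n" by (rule sub(1)[OF k v])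
    let ?e = "\<lambda>x. \<lambda>j\<in>{1..l}. if j = k then x else 0\<^sub>v n"
    have Fe: "?F (?e x) = x" if "x \<in> carrier_vec n" for x
    proof (rule eqI)
      have e: "?e x \<in> {1..l} \<rightarrow> carrier_vec n" using that by auto
      then show "?F (?e x) \<in> carrier_vec n" by (rule Fc)
      fix i assume i: "i < n"
      have "?F (?e x) $ i = (\<Sum>j\<in>{1..l}. if j = k then x $ i else 0)"
        unfolding Fi[OF e i] using i by (intro sum.cong) auto
      then show "?F (?e x) $ i = x $ i" using k by simp
    qed (use that in simp)
    have "comp v = ?e v"
    proof (rule comp_eq)
      show "?e v \<in> (\<Pi>\<^sub>E k\<in>{1..l}. U k)" using v sub(2) by (simp add: restrict_PiE_iff)
    qed (use Fe vc in auto)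
    then have "(\<lambda>j\<in>{1..l}. c j \<cdot>\<^sub>v comp v j) = ?e (c k \<cdot>\<^sub>v v)"
      by (intro restrict_ext) auto
    then show ?thesis
      unfolding f_def using Fe[of "c k \<cdot>\<^sub>v v"] vc by simp
  qed
  then show ?thesis
    using G(2) sub(1) by (intro bexI[OF _ G(1)] ballI) simp
qed



section \<open>The action of the gauge group\<close>

lemma GL_inverse_pair:
  assumes g: "g \<in> carrier (GL G d)" and i: "i \<in> verts G"
  shows "inverse_pair (d i) (g i) ((inv\<^bsub>GL G d\<^esub> g) i)"
proof -
  let ?M = "\<lambda>i. ring_mat TYPE(complex) (d i) ()"
  have grp: "group (units_of (?M i))" for i
    by (intro monoid.units_group ring.is_monoid ring_mat)
  have g': "g \<in> (\<Pi>\<^sub>E i\<in>verts G. carrier (units_of (?M i)))"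
    using g by (simp add: GL_def)
  have inv: "(inv\<^bsub>GL G d\<^esub> g) i = inv\<^bsub>units_of (?M i)\<^esub> (g i)"
    using inv_product_group[OF g' grp] i by (simp add: GL_def)
  have gi: "g i \<in> carrier (units_of (?M i))"
    using g' i by auto
  have "g i * (inv\<^bsub>GL G d\<^esub> g) i = 1\<^sub>m (d i)" "(inv\<^bsub>GL G d\<^esub> g) i * g i = 1\<^sub>m (d i)"
    using group.r_inv[OF grp gi] group.l_inv[OF grp gi]
    by (simp_all add: inv units_of_mult units_of_one ring_mat_simps)
  then show ?thesis
    using GL_carrier_mat[OF g i] by (simp add: inverse_pair_def)
qed

lemma restrict_in_GL:
  assumes "\<And>i. i \<in> verts G \<Longrightarrow> inverse_pair (d i) (g i) (g' i)"
  shows "restrict g (verts G) \<in> carrier (GL G d)"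
proof -
  have "g i \<in> carrier (units_of (ring_mat TYPE(complex) (d i) ()))" if "i \<in> verts G" for i
    using assms[OF that] by (auto simp: inverse_pair_def units_of_def Units_def ring_mat_simps)
  then show ?thesis
    by (simp add: GL_def restrict_PiE_iff)
qed

lemma RepD:
  "V \<in> Rep G d \<Longrightarrow> a \<in> arcs G \<Longrightarrow> V a \<in> carrier_mat (d (head G a)) (d (tail G a))"
  by (auto simp: Rep_def)

lemma ball_arcs_double:
  "(\<forall>b\<in>arcs (double G). A b) \<longleftrightarrow> (\<forall>a\<in>arcs G. A (Inl a) \<and> A (Inr a))"
  by (force simp: double_def elim!: PlusE)

lemma Rep_doubleD:
  assumes "V \<in> Rep (double G) d" "a \<in> arcs G"
  shows "V (Inl a) \<in> carrier_mat (d (head G a)) (d (tail G a))"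
    and "V (Inr a) \<in> carrier_mat (d (tail G a)) (d (head G a))"
  using RepD[OF assms(1), of "Inl a"] RepD[OF assms(1), of "Inr a"] assms(2)
  by (simp_all add: double_def InlI InrI)

lemma conj_matrix_eq_iff:
  assumes h: "inverse_pair n A A'" and t: "inverse_pair m B B'"
    and X: "X \<in> carrier_mat n m" and Y: "Y \<in> carrier_mat n m"
  shows "A * X * B' = Y \<longleftrightarrow> A * X = Y * B"
proof -
  have c: "A \<in> carrier_mat n n" "B \<in> carrier_mat m m" "B' \<in> carrier_mat m m"
    "B * B' = 1\<^sub>m m" "B' * B = 1\<^sub>m m"
    using h t by (auto simp: inverse_pair_def)
  have 1: "A * X * B' * B = A * X"
    using assoc_mult_mat[OF mult_carrier_mat[OF c(1) X] c(3) c(2)] c X by simp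
  have 2: "Y * B * B' = Y"
    using assoc_mult_mat[OF Y c(2) c(3)] c Y by simp
  show ?thesis
    using 1 2 by metis
qed

context wf_digraph
begin

lemma conj_act_closed:
  assumes "g \<in> carrier (GL G d)" "V \<in> Rep G d"
  shows "conj_act G d g V \<in> Rep G d"
  unfolding Rep_def conj_act_def restrict_PiE_iff
  using RepD[OF assms(2)] GL_carrier_mat[OF assms(1)] head_in_verts tail_in_verts
  by (metis mult_carrier_mat)

lemma conj_act_eq_iff:
  assumes g: "g \<in> carrier (GL G d)" and V: "V \<in> Rep G d" and W: "W \<in> Rep G d"
  shows "conj_act G d g V = W \<longleftrightarrow>
    (\<forall>a\<in>arcs G. g (head G a) * V a = W a * g (tail G a))"
proof -
  have "conj_act G d g V = W \<longleftrightarrow> (\<forall>a\<in>arcs G. conj_act G d g V a = W a)"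
    using PiE_ext[OF conj_act_closed[OF g V, unfolded Rep_def] W[unfolded Rep_def]] by auto
  also have "\<dots> \<longleftrightarrow> (\<forall>a\<in>arcs G. g (head G a) * V a = W a * g (tail G a))"
  proof (intro ball_cong refl)
    fix a assume a: "a \<in> arcs G"
    show "conj_act G d g V a = W a \<longleftrightarrow> g (head G a) * V a = W a * g (tail G a)"
      using conj_matrix_eq_iff[OF GL_inverse_pair[OF g head_in_verts[OF a]]
          GL_inverse_pair[OF g tail_in_verts[OF a]] RepD[OF V a] RepD[OF W a]] a
      by (simp add: conj_act_def)
  qed
  finally show ?thesis .
qed

lemma GL_group: "group (GL G d)"
  unfolding GL_def by (intro product_group monoid.units_group ring.is_monoid ring_mat)

lemma GL_mult: "i \<in> verts G \<Longrightarrow> (h \<otimes>\<^bsub>GL G d\<^esub> g) i = h i * g i"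
  by (simp add: GL_def units_of_mult ring_mat_simps)

lemma GL_one: "i \<in> verts G \<Longrightarrow> \<one>\<^bsub>GL G d\<^esub> i = 1\<^sub>m (d i)"
  by (simp add: GL_def units_of_one ring_mat_simps)

lemma conj_act_one:
  assumes "V \<in> Rep G d"
  shows "conj_act G d \<one>\<^bsub>GL G d\<^esub> V = V"
proof -
  interpret GL: group "GL G d" by (rule GL_group)
  show ?thesis
    unfolding conj_act_eq_iff[OF GL.one_closed assms assms]
    using RepD[OF assms]
    by (simp add: GL_one left_mult_one_mat[OF RepD[OF assms]] right_mult_one_mat[OF RepD[OF assms]])
qed

lemma conj_act_mult:
  assumes h: "h \<in> carrier (GL G d)" and g: "g \<in> carrier (GL G d)" and V: "V \<in> Rep G d"
  shows "conj_act G d (h \<otimes>\<^bsub>GL G d\<^esub> g) V = conj_act G d h (conj_act G d g V)"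
proof -
  interpret GL: group "GL G d" by (rule GL_group)
  let ?W = "conj_act G d g V"
  let ?Z = "conj_act G d h ?W"
  have W: "?W \<in> Rep G d" and Z: "?Z \<in> Rep G d"
    using assms by (auto intro: conj_act_closed)
  have "(h \<otimes>\<^bsub>GL G d\<^esub> g) (head G a) * V a = ?Z a * (h \<otimes>\<^bsub>GL G d\<^esub> g) (tail G a)"
    if a: "a \<in> arcs G" for a
  proof -
    note i = head_in_verts[OF a] tail_in_verts[OF a]
    note mats = GL_carrier_mat(1)[OF g i(1)] GL_carrier_mat(1)[OF g i(2)]
      GL_carrier_mat(1)[OF h i(1)] GL_carrier_mat(1)[OF h i(2)] RepD[OF V a] RepD[OF W a] RepD[OF Z a]
    have "h (head G a) * g (head G a) * V a = h (head G a) * (?W a * g (tail G a))"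
      using conj_act_eq_iff[OF g V W] a assoc_mult_mat[OF mats(3) mats(1) mats(5)] by simp
    also have "\<dots> = ?Z a * h (tail G a) * g (tail G a)"
      using conj_act_eq_iff[OF h W Z] a assoc_mult_mat[OF mats(3) mats(6) mats(2)] by simp
    also have "\<dots> = ?Z a * (h (tail G a) * g (tail G a))"
      by (rule assoc_mult_mat[OF mats(7) mats(4) mats(2)])
    finally show ?thesis by (simp add: GL_mult i)
  qed
  then show ?thesis
    using conj_act_eq_iff[OF GL.m_closed[OF h g] V Z] by simp
qed

lemma orbit_conj_act:
  assumes g: "g \<in> carrier (GL G d)" and V: "V \<in> Rep G d"
  shows "orbit (GL G d) (conj_act G d) (conj_act G d g V) = orbit (GL G d) (conj_act G d) V"
proof -
  interpret GL: group "GL G d" by (rule GL_group)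
  have "conj_act G d h (conj_act G d g V) \<in> orbit (GL G d) (conj_act G d) V"
    if "h \<in> carrier (GL G d)" for h
    using GL.m_closed[OF that g] unfolding orbit_def conj_act_mult[OF that g V, symmetric] by blast
  moreover have "conj_act G d h V \<in> orbit (GL G d) (conj_act G d) (conj_act G d g V)"
    if h: "h \<in> carrier (GL G d)" for h
  proof -
    let ?k = "h \<otimes>\<^bsub>GL G d\<^esub> inv\<^bsub>GL G d\<^esub> g"
    have k: "?k \<in> carrier (GL G d)" using h g by simp
    have "?k \<otimes>\<^bsub>GL G d\<^esub> g = h" using h g by (simp add: GL.m_assoc)
    then show ?thesis
      using conj_act_mult[OF k g V] k unfolding orbit_def by (intro CollectI exI[of _ ?k]) simp
  qed
  ultimately show ?thesis
    by (auto simp: orbit_def)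
qed

lemma orbit_self:
  assumes "V \<in> Rep G d"
  shows "V \<in> orbit (GL G d) (conj_act G d) V"
proof -
  interpret GL: group "GL G d" by (rule GL_group)
  show ?thesis
    using conj_act_one[OF assms] GL.one_closed unfolding orbit_def
    by (intro CollectI exI[of _ "\<one>\<^bsub>GL G d\<^esub>"]) simp
qed

lemma wf_double: "wf_digraph (double G)"
  by unfold_locales (auto simp: double_def)

lemma cstar_act_closed:
  assumes "V \<in> Rep (double G) d"
  shows "cstar_act G t V \<in> Rep (double G) d"
  unfolding Rep_def cstar_act_def restrict_PiE_iff
  using Rep_doubleD[OF assms] by (auto simp: double_def)

text \<open>
  The action on the moduli space takes the orbit of \<open>V\<close> to the orbit of \<open>t V\<close>, and two orbits agree as soon
  as one contains a point of the other.
\<close>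

lemma cstar_fixed_iff:
  assumes V: "V \<in> stable_locus G d \<theta>"
  shows "iso_class G d V \<in> cstar_fixed G d \<theta> \<longleftrightarrow>
    (\<forall>t. t \<noteq> 0 \<longrightarrow> (\<exists>g\<in>carrier (GL (double G) d). conj_act (double G) d g V = cstar_act G t V))"
proof -
  interpret D: wf_digraph "double G" by (rule wf_double)
  have R: "V \<in> Rep (double G) d"
    using V by (simp add: stable_locus_def nakajima_def)
  have "iso_class G d V \<in> moduli G d \<theta>"
    using V by (auto simp: iso_class_def moduli_def orbits_def)
  then have "iso_class G d V \<in> cstar_fixed G d \<theta> \<longleftrightarrow>
      (\<forall>t. t \<noteq> 0 \<longrightarrow> iso_class G d (cstar_act G t V) = iso_class G d V)"
    by (simp add: cstar_fixed_def cstar_iso_class[OF R])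
  also have "\<dots> \<longleftrightarrow> (\<forall>t. t \<noteq> 0 \<longrightarrow>
      (\<exists>g\<in>carrier (GL (double G) d). conj_act (double G) d g V = cstar_act G t V))"
  proof (intro all_cong1 imp_cong refl iffI)
    fix t :: complex
    assume "iso_class G d (cstar_act G t V) = iso_class G d V"
    then have "cstar_act G t V \<in> orbit (GL (double G) d) (conj_act (double G) d) V"
      using D.orbit_self[OF cstar_act_closed[OF R, of t]] by (simp only: iso_class_def)
    then show "\<exists>g\<in>carrier (GL (double G) d). conj_act (double G) d g V = cstar_act G t V"
      unfolding orbit_def by auto
  next
    fix t :: complex
    assume "\<exists>g\<in>carrier (GL (double G) d). conj_act (double G) d g V = cstar_act G t V"
    then show "iso_class G d (cstar_act G t V) = iso_class G d V"
      using D.orbit_conj_act[OF _ R] unfolding iso_class_def by metis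
  qed
  finally show ?thesis .
qed

lemma conj_act_eq_cstar_act_iff:
  assumes g: "g \<in> carrier (GL (double G) d)" and V: "V \<in> Rep (double G) d"
  shows "conj_act (double G) d g V = cstar_act G t V \<longleftrightarrow>
    (\<forall>a\<in>arcs G. g (head G a) * V (Inl a) = V (Inl a) * g (tail G a) \<and>
       g (tail G a) * V (Inr a) = t \<cdot>\<^sub>m (V (Inr a) * g (head G a)))"
proof -
  interpret D: wf_digraph "double G" by (rule wf_double)
  have "(t \<cdot>\<^sub>m V (Inr a)) * g (head G a) = t \<cdot>\<^sub>m (V (Inr a) * g (head G a))" if a: "a \<in> arcs G" for a
  proof (rule mult_smult_assoc_mat)
    show "V (Inr a) \<in> carrier_mat (d (tail G a)) (d (head G a))"
      by (rule Rep_doubleD(2)[OF V a])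
    show "g (head G a) \<in> carrier_mat (d (head G a)) (d (head G a))"
      using GL_carrier_mat(1)[OF g, of "head G a"] a by (simp add: double_def)
  qed
  then show ?thesis
    unfolding D.conj_act_eq_iff[OF g V cstar_act_closed[OF V]] ball_arcs_double
    by (intro ball_cong refl) (simp add: double_def cstar_act_def InlI InrI)
qed

end

section \<open>Gradings and fixed points\<close>

text \<open>
  The degree of \<open>x\<close> is \<open>\<lfloor>log\<^sub>2 \<bar>x\<bar>\<rfloor>\<close>.  It is bounded in absolute value by some \<open>N\<close> on a finite set, and
  adding \<open>N + 1\<close> moves it into \<open>{1..2 N + 1}\<close>.
\<close>

lemma dyadic_weights:
  fixes A :: "complex set"
  assumes "finite A" "0 \<notin> A"
  shows "\<exists>l > 0. \<exists>\<nu> :: complex \<Rightarrow> nat. (\<forall>x\<in>A. \<nu> x \<in> {1..l}) \<and>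
    (\<forall>x\<in>A. \<forall>y\<in>A. x = 2 * y \<longrightarrow> \<nu> x = \<nu> y + 1)"
proof -
  define e where "e x = \<lfloor>log 2 (cmod x)\<rfloor>" for x
  define N where "N = Max (insert 0 ((\<lambda>x. \<bar>e x\<bar>) ` A))"
  have N: "\<bar>e x\<bar> \<le> N" if "x \<in> A" for x
    unfolding N_def using assms(1) that by (intro Max_ge) auto
  have "0 \<le> N"
    unfolding N_def using assms(1) by (intro Max_ge) auto
  let ?\<nu> = "\<lambda>x. nat (e x + N + 1)" and ?l = "nat (2 * N + 1)"
  have "?l > 0" using \<open>0 \<le> N\<close> by simp
  moreover have "\<forall>x\<in>A. ?\<nu> x \<in> {1..?l}"
    using N by fastforce
  moreover have "?\<nu> x = ?\<nu> y + 1" if "x \<in> A" "y \<in> A" "x = 2 * y" for x y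
  proof -
    have "y \<noteq> 0" using that assms(2) by auto
    then have "log 2 (cmod x) = log 2 (cmod y) + 1"
      using that(3) by (simp add: norm_mult log_mult)
    then have "e x = e y + 1" by (simp add: e_def)
    then show ?thesis using N[OF that(2)] by simp
  qed
  then have "\<forall>x\<in>A. \<forall>y\<in>A. x = 2 * y \<longrightarrow> ?\<nu> x = ?\<nu> y + 1"
    by (intro ballI impI)
  ultimately show ?thesis
    by (intro exI[of _ ?l] exI[of _ ?\<nu>] conjI)
qed

text \<open>
  Whenever the matrix of \<open>Y\<close> has a nonzero entry from one coordinate to another, the weight doubles, so the
  degree rises by one; for \<open>X\<close> both are unchanged.
\<close>

lemma cstar_eigen_imp_grading:
  fixes Q :: "('v, 'a) pre_digraph"
  assumes Q: "fin_digraph Q" and V: "V \<in> Rep (double Q) d"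
    and g: "g \<in> carrier (GL (double Q) d)"
    and gV: "conj_act (double Q) d g V = cstar_act Q 2 V"
  shows "\<exists>l > 0. \<exists>U :: 'v \<Rightarrow> nat \<Rightarrow> complex vec set.
      (\<forall>i \<in> verts Q. splitting (d i) l (U i)) \<and>
      (\<forall>a \<in> arcs Q.
        (\<forall>n \<in> {1..l}. \<forall>v \<in> U (tail Q a) n. V (Inl a) *\<^sub>v v \<in> U (head Q a) n) \<and>
        (\<forall>n \<in> {1..<l}. \<forall>v \<in> U (head Q a) n. V (Inr a) *\<^sub>v v \<in> U (tail Q a) (n + 1)) \<and>
        (\<forall>v \<in> U (head Q a) l. V (Inr a) *\<^sub>v v = 0\<^sub>v (d (tail Q a))))"
proof -
  interpret fin_digraph Q by (rule Q)
  have vd: "verts (double Q) = verts Q" by (simp add: double_def)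
  have "\<forall>i\<in>verts Q. \<exists>C. case C of (P, R, J) \<Rightarrow>
      inverse_pair (d i) P R \<and> eigenblock_triangular (d i) J \<and> g i = P * J * R \<and>
      (\<forall>k<d i. J $$ (k, k) \<noteq> 0)"
    using eigenvalue_coordinates_exist[OF GL_inverse_pair[OF g, unfolded vd]] by (simp add: split_paired_Ex)
  from bchoice[OF this] obtain C where C: "\<forall>i\<in>verts Q. case C i of (P, R, J) \<Rightarrow>
      inverse_pair (d i) P R \<and> eigenblock_triangular (d i) J \<and> g i = P * J * R \<and>
      (\<forall>k<d i. J $$ (k, k) \<noteq> 0)" ..
  define P where "P i = fst (C i)" for i
  define R where "R i = fst (snd (C i))" for i
  define J where "J i = snd (snd (C i))" for i
  have PR: "inverse_pair (d i) (P i) (R i)" and J: "eigenblock_triangular (d i) (J i)"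
    and gi: "g i = P i * J i * R i" and nz: "k < d i \<Longrightarrow> J i $$ (k, k) \<noteq> 0"
    if "i \<in> verts Q" for i k
  proof -
    have Ci: "C i = (P i, R i, J i)"
      by (simp add: P_def R_def J_def)
    from bspec[OF C that] have *: "inverse_pair (d i) (P i) (R i) \<and> eigenblock_triangular (d i) (J i) \<and>
        g i = P i * J i * R i \<and> (\<forall>k<d i. J i $$ (k, k) \<noteq> 0)"
      unfolding Ci prod.case .
    note * = conjunct1[OF *] conjunct2[OF *, THEN conjunct1]
      conjunct2[OF *, THEN conjunct2, THEN conjunct1] conjunct2[OF *, THEN conjunct2, THEN conjunct2]
    show "inverse_pair (d i) (P i) (R i)" by (rule *(1))
    show "eigenblock_triangular (d i) (J i)" by (rule *(2))
    show "g i = P i * J i * R i" by (rule *(3))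
    show "k < d i \<Longrightarrow> J i $$ (k, k) \<noteq> 0" using *(4) by blast
  qed
  \<comment> \<open>The coordinate \<open>k\<close> at the vertex \<open>i\<close> has weight \<open>\<omega> i k\<close> and is put in degree \<open>\<nu> (\<omega> i k)\<close>.\<close>
  let ?\<omega> = "\<lambda>i k. J i $$ (k, k)"
  let ?A = "\<Union>i\<in>verts Q. ?\<omega> i ` {..<d i}"
  have "finite ?A" by simp
  moreover have "0 \<notin> ?A"
  proof
    assume "0 \<in> ?A"
    then obtain i k where "i \<in> verts Q" "k < d i" "?\<omega> i k = 0" by auto
    with nz show False by blast
  qed
  ultimately have "\<exists>l > 0. \<exists>\<nu> :: complex \<Rightarrow> nat. (\<forall>x\<in>?A. \<nu> x \<in> {1..l}) \<and>
    (\<forall>x\<in>?A. \<forall>y\<in>?A. x = 2 * y \<longrightarrow> \<nu> x = \<nu> y + 1)"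
    by (rule dyadic_weights)
  then obtain l :: nat and \<nu> :: "complex \<Rightarrow> nat" where l: "l > 0" and degrees: "\<forall>x\<in>?A. \<nu> x \<in> {1..l}"
    and doubling: "\<forall>x\<in>?A. \<forall>y\<in>?A. x = 2 * y \<longrightarrow> \<nu> x = \<nu> y + 1"
    by (elim exE conjE)
  note \<nu> = bspec[OF degrees]
  note \<nu>2 = bspec[OF bspec[OF doubling], rule_format]
  have inA: "?\<omega> i k \<in> ?A" if "i \<in> verts Q" "k < d i" for i k
    using that by auto
  let ?U = "\<lambda>i n. coord_span (d i) (R i) {k. \<nu> (?\<omega> i k) = n}"
  have split: "splitting (d i) l (?U i)" if "i \<in> verts Q" for i
    using \<nu>[OF inA[OF that]] by (intro coord_span_splitting[OF PR[OF that]])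
  \<comment> \<open>The factor \<open>1\<close> gives both equations the shape expected by \<open>intertwiner_entry_weights\<close>.\<close>
  have intertwine: "g (head Q a) * V (Inl a) = 1 \<cdot>\<^sub>m (V (Inl a) * g (tail Q a))"
    "g (tail Q a) * V (Inr a) = 2 \<cdot>\<^sub>m (V (Inr a) * g (head Q a))" if "a \<in> arcs Q" for a
    using gV that unfolding conj_act_eq_cstar_act_iff[OF g V] by auto
  note Vc = Rep_doubleD[OF V]
  have X_maps: "V (Inl a) *\<^sub>v v \<in> ?U (head Q a) n"
    if a: "a \<in> arcs Q" and v: "v \<in> ?U (tail Q a) n" for a n v
  proof (rule coord_span_mapsto[OF PR[OF head_in_verts[OF a]] PR[OF tail_in_verts[OF a]] Vc(1)[OF a] _ v])
    fix k k' assume k: "k < d (head Q a)" "k' < d (tail Q a)"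
      and ne: "(R (head Q a) * V (Inl a) * P (tail Q a)) $$ (k, k') \<noteq> 0"
      and k': "k' \<in> {k. \<nu> (?\<omega> (tail Q a) k) = n}"
    have "?\<omega> (head Q a) k = 1 * ?\<omega> (tail Q a) k'"
      using intertwine(1)[OF a] unfolding gi[OF head_in_verts[OF a]] gi[OF tail_in_verts[OF a]]
      by (rule intertwiner_entry_weights[OF PR[OF head_in_verts[OF a]] PR[OF tail_in_verts[OF a]]
            J[OF head_in_verts[OF a]] J[OF tail_in_verts[OF a]] Vc(1)[OF a] _ k ne])
    then show "k \<in> {k. \<nu> (?\<omega> (head Q a) k) = n}" using k' by simp
  qed
  have Y_weights: "\<nu> (?\<omega> (tail Q a) k) = \<nu> (?\<omega> (head Q a) k') + 1"
    if a: "a \<in> arcs Q" and k: "k < d (tail Q a)" "k' < d (head Q a)"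
      and ne: "(R (tail Q a) * V (Inr a) * P (head Q a)) $$ (k, k') \<noteq> 0" for a k k'
  proof (rule \<nu>2[OF inA inA])
    show "?\<omega> (tail Q a) k = 2 * ?\<omega> (head Q a) k'"
      using intertwine(2)[OF a] unfolding gi[OF head_in_verts[OF a]] gi[OF tail_in_verts[OF a]]
      by (rule intertwiner_entry_weights[OF PR[OF tail_in_verts[OF a]] PR[OF head_in_verts[OF a]]
            J[OF tail_in_verts[OF a]] J[OF head_in_verts[OF a]] Vc(2)[OF a] _ k ne])
  qed (use a k in auto)
  have Y_maps: "V (Inr a) *\<^sub>v v \<in> ?U (tail Q a) (n + 1)"
    if a: "a \<in> arcs Q" and v: "v \<in> ?U (head Q a) n" for a n v
    by (rule coord_span_mapsto[OF PR[OF tail_in_verts[OF a]] PR[OF head_in_verts[OF a]] Vc(2)[OF a] _ v])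
      (use Y_weights[OF a] in simp)
  have Y_zero: "V (Inr a) *\<^sub>v v = 0\<^sub>v (d (tail Q a))"
    if a: "a \<in> arcs Q" and v: "v \<in> ?U (head Q a) l" for a v
  proof -
    have "V (Inr a) *\<^sub>v v \<in> coord_span (d (tail Q a)) (R (tail Q a)) {}"
    proof (rule coord_span_mapsto[OF PR[OF tail_in_verts[OF a]] PR[OF head_in_verts[OF a]] Vc(2)[OF a] _ v])
      fix k k' assume k: "k < d (tail Q a)" "k' < d (head Q a)"
        and ne: "(R (tail Q a) * V (Inr a) * P (head Q a)) $$ (k, k') \<noteq> 0"
        and k': "k' \<in> {k. \<nu> (?\<omega> (head Q a) k) = l}"
      have "\<nu> (?\<omega> (tail Q a) k) \<le> l"
        using \<nu>[OF inA[OF tail_in_verts[OF a] k(1)]] by simp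
      then show "k \<in> {}" using Y_weights[OF a k ne] k' by simp
    qed
    then show ?thesis
      using coord_span_empty[OF PR[OF tail_in_verts[OF a]], of "{}"] by simp
  qed
  show ?thesis
    by (intro exI[of _ l] conjI l exI[of _ ?U] ballI split X_maps Y_maps Y_zero)
qed

lemma smult_mat_mult_vec:
  assumes "A \<in> carrier_mat n m" "v \<in> carrier_vec m"
  shows "(t \<cdot>\<^sub>m A) *\<^sub>v v = t \<cdot>\<^sub>v (A *\<^sub>v (v :: complex vec))"
  using assms by (intro eq_vecI) auto

lemma grading_imp_cstar_eigen:
  assumes Q: "wf_digraph Q" and V: "V \<in> Rep (double Q) d" and t: "t \<noteq> 0"
    and sp: "\<And>i. i \<in> verts Q \<Longrightarrow> splitting (d i) l (U i)"
    and X: "\<And>a n v. a \<in> arcs Q \<Longrightarrow> n \<in> {1..l} \<Longrightarrow> v \<in> U (tail Q a) n \<Longrightarrow> V (Inl a) *\<^sub>v v \<in> U (head Q a) n"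
    and Y: "\<And>a n v. a \<in> arcs Q \<Longrightarrow> n \<in> {1..<l} \<Longrightarrow> v \<in> U (head Q a) n \<Longrightarrow> V (Inr a) *\<^sub>v v \<in> U (tail Q a) (n + 1)"
    and Y0: "\<And>a v. a \<in> arcs Q \<Longrightarrow> v \<in> U (head Q a) l \<Longrightarrow> V (Inr a) *\<^sub>v v = 0\<^sub>v (d (tail Q a))"
  shows "\<exists>g\<in>carrier (GL (double Q) d). conj_act (double Q) d g V = cstar_act Q t V"
proof -
  interpret wf_digraph Q by (rule Q)
  have vd: "verts (double Q) = verts Q" by (simp add: double_def)
  have sub: "v \<in> carrier_vec (d i)" if "i \<in> verts Q" "n \<in> {1..l}" "v \<in> U i n" for i n v
    using sp[OF that(1)] that(2,3) unfolding splitting_def lin_subspace_iff by blast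
  have ex: "\<exists>G. G \<in> carrier_mat (d i) (d i) \<and> (\<forall>n\<in>{1..l}. \<forall>v\<in>U i n. G *\<^sub>v v = s ^ n \<cdot>\<^sub>v v)"
    if "i \<in> verts Q" for s :: complex and i
    using splitting_scaling_matrix[OF sp[OF that], of "\<lambda>n. s ^ n"] by blast
  \<comment> \<open>\<open>E s\<close> is the automorphism \<open>g\<^sub>s\<close> of the graded space; \<open>E (1 / t)\<close> serves as the inverse of \<open>E t\<close>.\<close>
  define E where "E s i = (SOME G. G \<in> carrier_mat (d i) (d i) \<and>
      (\<forall>n\<in>{1..l}. \<forall>v\<in>U i n. G *\<^sub>v v = s ^ n \<cdot>\<^sub>v v))" for s :: complex and i
  have Ec: "E s i \<in> carrier_mat (d i) (d i)"
    and Ev: "n \<in> {1..l} \<Longrightarrow> v \<in> U i n \<Longrightarrow> E s i *\<^sub>v v = s ^ n \<cdot>\<^sub>v v" if "i \<in> verts Q" for s i n v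
    using someI_ex[OF ex[OF that, of s]] unfolding E_def by blast+
  have Einv: "E s i * E s' i = 1\<^sub>m (d i)" if i: "i \<in> verts Q" and ss: "s * s' = 1" for s s' i
  proof (rule splitting_ext[OF sp[OF i]])
    fix n v assume n: "n \<in> {1..l}" "v \<in> U i n"
    have vc: "v \<in> carrier_vec (d i)" using sub[OF i n] .
    have "(E s i * E s' i) *\<^sub>v v = E s i *\<^sub>v (s' ^ n \<cdot>\<^sub>v v)"
      using Ec[OF i] vc Ev[OF i n] by (simp add: assoc_mult_mat_vec[of _ "d i" "d i" _ "d i"])
    also have "\<dots> = (s' ^ n * s ^ n) \<cdot>\<^sub>v v"
      using mult_mat_vec[OF Ec[OF i] vc] Ev[OF i n] by (simp add: smult_smult_assoc)
    also have "s' ^ n * s ^ n = 1"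
      using ss by (metis mult.commute power_mult_distrib power_one)
    finally show "(E s i * E s' i) *\<^sub>v v = 1\<^sub>m (d i) *\<^sub>v v" using vc by simp
  qed (rule mult_carrier_mat[OF Ec[OF i] Ec[OF i]], rule one_carrier_mat)
  let ?g = "restrict (E t) (verts (double Q))"
  have g: "?g \<in> carrier (GL (double Q) d)"
  proof (rule restrict_in_GL)
    fix i assume "i \<in> verts (double Q)"
    then have i: "i \<in> verts Q" by (simp add: vd)
    show "inverse_pair (d i) (E t i) (E (1 / t) i)"
      using Ec[OF i] Einv[OF i, of t "1 / t"] Einv[OF i, of "1 / t" t] t by (simp add: inverse_pair_def)
  qed
  have "E t (head Q a) * V (Inl a) = V (Inl a) * E t (tail Q a)" if a: "a \<in> arcs Q" for a
  proof (rule splitting_ext[OF sp[OF tail_in_verts[OF a]]])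
    have Xc: "V (Inl a) \<in> carrier_mat (d (head Q a)) (d (tail Q a))"
      by (rule Rep_doubleD(1)[OF V a])
    note h = Ec[OF head_in_verts[OF a], of t] and tl = Ec[OF tail_in_verts[OF a], of t]
    show "E t (head Q a) * V (Inl a) \<in> carrier_mat (d (head Q a)) (d (tail Q a))"
      "V (Inl a) * E t (tail Q a) \<in> carrier_mat (d (head Q a)) (d (tail Q a))"
      using h tl Xc by auto
    fix n v assume n: "n \<in> {1..l}" "v \<in> U (tail Q a) n"
    have vc: "v \<in> carrier_vec (d (tail Q a))" using sub[OF tail_in_verts[OF a] n] .
    have "(E t (head Q a) * V (Inl a)) *\<^sub>v v = t ^ n \<cdot>\<^sub>v (V (Inl a) *\<^sub>v v)"
      using assoc_mult_mat_vec[OF h Xc vc] Ev[OF head_in_verts[OF a] n(1) X[OF a n]] by simp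
    also have "\<dots> = (V (Inl a) * E t (tail Q a)) *\<^sub>v v"
      using assoc_mult_mat_vec[OF Xc tl vc] Ev[OF tail_in_verts[OF a] n] mult_mat_vec[OF Xc vc] by simp
    finally show "(E t (head Q a) * V (Inl a)) *\<^sub>v v = (V (Inl a) * E t (tail Q a)) *\<^sub>v v" .
  qed
  moreover have "E t (tail Q a) * V (Inr a) = t \<cdot>\<^sub>m (V (Inr a) * E t (head Q a))" if a: "a \<in> arcs Q" for a
  proof (rule splitting_ext[OF sp[OF head_in_verts[OF a]]])
    have Yc: "V (Inr a) \<in> carrier_mat (d (tail Q a)) (d (head Q a))"
      by (rule Rep_doubleD(2)[OF V a])
    note h = Ec[OF head_in_verts[OF a], of t] and tl = Ec[OF tail_in_verts[OF a], of t]
    show "E t (tail Q a) * V (Inr a) \<in> carrier_mat (d (tail Q a)) (d (head Q a))"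
      "t \<cdot>\<^sub>m (V (Inr a) * E t (head Q a)) \<in> carrier_mat (d (tail Q a)) (d (head Q a))"
      using h tl Yc by auto
    fix n v assume n: "n \<in> {1..l}" "v \<in> U (head Q a) n"
    have vc: "v \<in> carrier_vec (d (head Q a))" using sub[OF head_in_verts[OF a] n] .
    \<comment> \<open>In the last degree both sides are \<open>0\<close>; otherwise \<open>Y v\<close> has degree \<open>n + 1\<close>.\<close>
    have "E t (tail Q a) *\<^sub>v (V (Inr a) *\<^sub>v v) = t ^ Suc n \<cdot>\<^sub>v (V (Inr a) *\<^sub>v v)"
    proof (cases "n = l")
      case True
      have "V (Inr a) *\<^sub>v v = 0\<^sub>v (d (tail Q a))"
        using Y0[OF a] n True by simp
      then show ?thesis
        using tl by (intro eq_vecI) auto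
    next
      case False
      then show ?thesis
        using Ev[OF tail_in_verts[OF a] _ Y[OF a _ n(2)]] n(1) by simp
    qed
    moreover have "(t \<cdot>\<^sub>m (V (Inr a) * E t (head Q a))) *\<^sub>v v = t ^ Suc n \<cdot>\<^sub>v (V (Inr a) *\<^sub>v v)"
      using smult_mat_mult_vec[OF mult_carrier_mat[OF Yc h] vc, of t]
        assoc_mult_mat_vec[OF Yc h vc] Ev[OF head_in_verts[OF a] n] mult_mat_vec[OF Yc vc] h Yc vc
      by (simp add: smult_smult_assoc)
    ultimately show "(E t (tail Q a) * V (Inr a)) *\<^sub>v v = (t \<cdot>\<^sub>m (V (Inr a) * E t (head Q a))) *\<^sub>v v"
      using assoc_mult_mat_vec[OF tl Yc vc] by simp
  qed
  ultimately have "conj_act (double Q) d ?g V = cstar_act Q t V"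
    unfolding conj_act_eq_cstar_act_iff[OF g V] by (simp add: vd)
  with g show ?thesis by blast
qed


theorem theorem3p2:
  fixes Q :: "('v, 'a) pre_digraph" and d :: "'v \<Rightarrow> nat" and \<theta> :: "'v \<Rightarrow> int"
    and V :: "'a + 'a \<Rightarrow> complex mat"
  assumes "fin_digraph Q"
    and "acyclic (arcs_ends Q)"
    and "generic Q d \<theta>"
    and "V \<in> stable_locus Q d \<theta>"
  shows "iso_class Q d V \<in> cstar_fixed Q d \<theta> \<longleftrightarrow>
    (\<exists>l > 0. \<exists>U :: 'v \<Rightarrow> nat \<Rightarrow> complex vec set.
      (\<forall>i \<in> verts Q. splitting (d i) l (U i)) \<and>
      (\<forall>a \<in> arcs Q.
        (\<forall>n \<in> {1..l}. \<forall>v \<in> U (tail Q a) n. V (Inl a) *\<^sub>v v \<in> U (head Q a) n) \<and>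
        (\<forall>n \<in> {1..<l}. \<forall>v \<in> U (head Q a) n. V (Inr a) *\<^sub>v v \<in> U (tail Q a) (n + 1)) \<and>
        (\<forall>v \<in> U (head Q a) l. V (Inr a) *\<^sub>v v = 0\<^sub>v (d (tail Q a)))))"
    (is "?fixed \<longleftrightarrow> ?graded")
proof -
  interpret fin_digraph Q by (rule assms(1))
  have V: "V \<in> Rep (double Q) d"
    using assms(4) by (simp add: stable_locus_def nakajima_def)
  note fixed_iff = cstar_fixed_iff[OF assms(4)]
  show ?thesis
  proof
    assume ?fixed
    then obtain g where "g \<in> carrier (GL (double Q) d)" "conj_act (double Q) d g V = cstar_act Q 2 V"
      unfolding fixed_iff by (metis zero_neq_numeral)
    then show ?graded
      by (rule cstar_eigen_imp_grading[OF assms(1) V])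
  next
    assume ?graded
    then obtain l U where "\<forall>i \<in> verts Q. splitting (d i) l (U i)"
      and "\<forall>a \<in> arcs Q.
        (\<forall>n \<in> {1..l}. \<forall>v \<in> U (tail Q a) n. V (Inl a) *\<^sub>v v \<in> U (head Q a) n) \<and>
        (\<forall>n \<in> {1..<l}. \<forall>v \<in> U (head Q a) n. V (Inr a) *\<^sub>v v \<in> U (tail Q a) (n + 1)) \<and>
        (\<forall>v \<in> U (head Q a) l. V (Inr a) *\<^sub>v v = 0\<^sub>v (d (tail Q a)))"
      by (elim exE conjE)
    then show ?fixed
      unfolding fixed_iff
      by (intro allI impI grading_imp_cstar_eigen[OF wf_digraph_axioms V, of _ l U]) auto
  qed
qed

end
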